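(* Let $(M^n,g)$ be a complete Riemannian spin manifold without boundary and let $f\in C^\infty(M)$. The Dirac operator $D$ and the weighted Dirac operator $D_f$ are unitarily equivalent and hence isospectral; on $C^1$-spinors, these operators are related by $$U_fDU_f^{-1}=D_f .$$ In particular, $D\psi=0$ if and only if $D_f(e^{f/2}\psi)=0$.
   Context: $\Sigma M\to M$ is the complex spinor bundle with its Hermitian metric, Clifford multiplication $\cdot$ (convention $X\cdot Y\cdot\psi+Y\cdot X\cdot\psi=-2g(X,Y)\psi$), and spin connection $\nabla$ induced by the Levi-Civita connection. A spinor is a section of $\Sigma M$. In a local orthonormal frame the Dirac operator is $D=\sum_i e_i\cdot\nabla_{e_i}$, and the weighted Dirac operator is $D_f\psi=D\psi-\frac12(\nabla f)\cdot\psi$. $L^2=L^2(\Sigma M,dV)$ and $L^2_f=L^2(\Sigma M,e^{-f}dV)$ are the unweighted and weighted spaces of square-integrable spinors, where $dV$ is the Riemannian volume measure. $U_f:L^2\to L^2_f$ is the unitary map $U_f\psi=e^{f/2}\psi$, with inverse $U_f^{-1}=U_{-f}$ (multiplication by $e^{-f/2}$). Two operators $A,B$ acting on Hilbert spaces with domains of definition $\mathcal{D}_A,\mathcal{D}_B$ are unitarily equivalent if there is a unitary operator $U$ with $U\mathcal{D}_A=\mathcal{D}_B$ and $UAU^{-1}x=Bx$ for all $x\in\mathcal{D}_B$. *)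

theory Defs
  imports "HOL-Analysis.Analysis"
begin

section \<open>Maps of class C^k on open sets\<close>

text \<open>To be used on open sets only: all derivatives are taken at interior points.\<close>

fun Ck_on :: "nat \<Rightarrow> 'a::euclidean_space set \<Rightarrow> ('a \<Rightarrow> 'b::real_normed_vector) \<Rightarrow> bool" where
  "Ck_on 0 S h \<longleftrightarrow> continuous_on S h"
| "Ck_on (Suc k) S h \<longleftrightarrow> (\<forall>x\<in>S. h differentiable (at x)) \<and>
     (\<forall>b\<in>Basis. Ck_on k S (\<lambda>x. frechet_derivative h (at x) b))"

definition smooth_on :: "'a::euclidean_space set \<Rightarrow> ('a \<Rightarrow> 'b::real_normed_vector) \<Rightarrow> bool" where
  "smooth_on S h \<longleftrightarrow> (\<forall>k. Ck_on k S h)"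

section \<open>Oriented Riemannian manifolds\<close>

text \<open>
  A chart is a pair of an open domain and a coordinate map.  Tensors are given by their components:
  a tangent vector at a point assigns to every chart around the point a coordinate vector, and a
  Riemannian metric assigns to every chart and point the matrix of its coefficients; both transform
  under a change of charts by the Jacobian.
\<close>

type_synonym ('m, 'n) chart = "'m set \<times> ('m \<Rightarrow> real ^ 'n)"
type_synonym ('m, 'n) tangent = "('m, 'n) chart \<Rightarrow> real ^ 'n"

record ('m, 'n) riem =
  charts :: "('m, 'n::finite) chart set"
  gmat :: "('m, 'n) chart \<Rightarrow> 'm \<Rightarrow> real ^ 'n ^ 'n"

abbreviation cdom :: "('m, 'n::finite) chart \<Rightarrow> 'm set" where "cdom c \<equiv> fst c"
abbreviation cmap :: "('m, 'n::finite) chart \<Rightarrow> 'm \<Rightarrow> real ^ 'n" where "cmap c \<equiv> snd c"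

definition cinv :: "('m, 'n::finite) chart \<Rightarrow> real ^ 'n \<Rightarrow> 'm" where
  "cinv c = inv_into (cdom c) (cmap c)"

definition jacobian ::
    "('m, 'n::finite) chart \<Rightarrow> ('m, 'n) chart \<Rightarrow> 'm \<Rightarrow> real ^ 'n ^ 'n" where
  "jacobian c d x = matrix (frechet_derivative (cmap d \<circ> cinv c) (at (cmap c x)))"

text \<open>Second countability and the Hausdorff property are sort constraints on \<open>'m\<close>.
  The positivity of the Jacobians says that the atlas is oriented.\<close>

definition oriented_atlas ::
    "('m::{t2_space, second_countable_topology}, 'n::finite) chart set \<Rightarrow> bool" where
  "oriented_atlas C \<longleftrightarrow>
     (\<Union>c\<in>C. cdom c) = UNIV \<and>
     (\<forall>c\<in>C. open (cdom c) \<and> open (cmap c ` cdom c) \<and>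
        homeomorphism (cdom c) (cmap c ` cdom c) (cmap c) (cinv c)) \<and>
     (\<forall>c\<in>C. \<forall>d\<in>C. smooth_on (cmap c ` (cdom c \<inter> cdom d)) (cmap d \<circ> cinv c) \<and>
        (\<forall>x\<in>cdom c \<inter> cdom d. det (jacobian c d x) > 0))"

definition riemannian_metric :: "('m, 'n::finite, 'z) riem_scheme \<Rightarrow> bool" where
  "riemannian_metric M \<longleftrightarrow>
     (\<forall>c\<in>charts M. smooth_on (cmap c ` cdom c) (gmat M c \<circ> cinv c) \<and>
        (\<forall>x\<in>cdom c. transpose (gmat M c x) = gmat M c x \<and>
           (\<forall>v. v \<noteq> 0 \<longrightarrow> v \<bullet> (gmat M c x *v v) > 0))) \<and>
     (\<forall>c\<in>charts M. \<forall>d\<in>charts M. \<forall>x\<in>cdom c \<inter> cdom d.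
        gmat M c x = transpose (jacobian c d x) ** gmat M d x ** jacobian c d x)"

definition oriented_riemannian_manifold ::
    "('m::{t2_space, second_countable_topology}, 'n::finite, 'z) riem_scheme \<Rightarrow> bool" where
  "oriented_riemannian_manifold M \<longleftrightarrow> oriented_atlas (charts M) \<and> riemannian_metric M"

definition smooth_fun :: "('m, 'n::finite, 'z) riem_scheme \<Rightarrow> ('m \<Rightarrow> real) \<Rightarrow> bool" where
  "smooth_fun M f \<longleftrightarrow> (\<forall>c\<in>charts M. smooth_on (cmap c ` cdom c) (f \<circ> cinv c))"

definition is_chart_at :: "('m, 'n::finite, 'z) riem_scheme \<Rightarrow> ('m, 'n) chart \<Rightarrow> 'm \<Rightarrow> bool" where
  "is_chart_at M c x \<longleftrightarrow> c \<in> charts M \<and> x \<in> cdom c"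

text \<open>A choice of chart at each point.  It is used below only to evaluate expressions whose value
  does not depend on the chart.\<close>

definition chart_at :: "('m, 'n::finite, 'z) riem_scheme \<Rightarrow> 'm \<Rightarrow> ('m, 'n) chart" where
  "chart_at M x = (SOME c. is_chart_at M c x)"

text \<open>The values at charts not containing the point are normalised to 0, so that equality of
  tangent vectors is equality of functions.\<close>

definition tangent_space :: "('m, 'n::finite, 'z) riem_scheme \<Rightarrow> 'm \<Rightarrow> ('m, 'n) tangent set" where
  "tangent_space M x = {v.
     (\<forall>c d. is_chart_at M c x \<and> is_chart_at M d x \<longrightarrow> v d = jacobian c d x *v v c) \<and>
     (\<forall>c. \<not> is_chart_at M c x \<longrightarrow> v c = 0)}"

definition ginner ::
    "('m, 'n::finite, 'z) riem_scheme \<Rightarrow> 'm \<Rightarrow> ('m, 'n) tangent \<Rightarrow> ('m, 'n) tangent \<Rightarrow> real" where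
  "ginner M x u v = (let c = chart_at M x in u c \<bullet> (gmat M c x *v v c))"

definition directional ::
    "('m, 'n::finite) chart \<Rightarrow> 'm \<Rightarrow> real ^ 'n \<Rightarrow> ('m \<Rightarrow> 'b::real_normed_vector) \<Rightarrow> 'b" where
  "directional c x v h = frechet_derivative (h \<circ> cinv c) (at (cmap c x)) v"

definition grad :: "('m, 'n::finite, 'z) riem_scheme \<Rightarrow> ('m \<Rightarrow> real) \<Rightarrow> 'm \<Rightarrow> ('m, 'n) tangent" where
  "grad M f x = (\<lambda>c. if is_chart_at M c x
     then matrix_inv (gmat M c x) *v (\<chi> i. directional c x (axis i 1) f) else 0)"

definition christoffel ::
    "('m, 'n::finite, 'z) riem_scheme \<Rightarrow> ('m, 'n) chart \<Rightarrow> 'm \<Rightarrow> 'n \<Rightarrow> 'n \<Rightarrow> 'n \<Rightarrow> real" where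
  "christoffel M c x k i j =
     (let dg = (\<lambda>a b d. directional c x (axis a 1) (\<lambda>y. gmat M c y $ b $ d))
      in 1/2 * (\<Sum>l\<in>UNIV. matrix_inv (gmat M c x) $ k $ l * (dg i j l + dg j i l - dg l i j)))"

text \<open>Levi-Civita derivative of a vector field \<open>Y\<close> in direction \<open>v\<close>; components in the chart \<open>c\<close>.\<close>

definition levi_civita ::
    "('m, 'n::finite, 'z) riem_scheme \<Rightarrow> 'm \<Rightarrow> ('m, 'n) tangent \<Rightarrow> ('m \<Rightarrow> ('m, 'n) tangent)
      \<Rightarrow> ('m, 'n) tangent" where
  "levi_civita M x v Y = (\<lambda>c. if is_chart_at M c x
     then directional c x (v c) (\<lambda>y. Y y c) +
       (\<chi> k. \<Sum>i\<in>UNIV. \<Sum>j\<in>UNIV. christoffel M c x k i j * v c $ i * Y x c $ j)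
     else 0)"

subsection \<open>Completeness and the Riemannian measure\<close>

definition piecewise_C1_curve ::
    "('m::topological_space, 'n::finite, 'z) riem_scheme \<Rightarrow> (real \<Rightarrow> 'm) \<Rightarrow> bool" where
  "piecewise_C1_curve M w \<longleftrightarrow> continuous_on {0..1} w \<and>
     (\<forall>c\<in>charts M. \<forall>a b. 0 \<le> a \<and> a < b \<and> b \<le> 1 \<and> w ` {a..b} \<subseteq> cdom c \<longrightarrow>
        (cmap c \<circ> w) piecewise_C1_differentiable_on {a..b})"

definition speed :: "('m, 'n::finite, 'z) riem_scheme \<Rightarrow> (real \<Rightarrow> 'm) \<Rightarrow> real \<Rightarrow> real" where
  "speed M w t = (let c = chart_at M (w t); v = vector_derivative (cmap c \<circ> w) (at t)
                  in sqrt (v \<bullet> (gmat M c (w t) *v v)))"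

definition curve_length :: "('m, 'n::finite, 'z) riem_scheme \<Rightarrow> (real \<Rightarrow> 'm) \<Rightarrow> ennreal" where
  "curve_length M w = (\<integral>\<^sup>+ t\<in>{0..1}. ennreal (speed M w t) \<partial>lborel)"

definition riem_dist ::
    "('m::topological_space, 'n::finite, 'z) riem_scheme \<Rightarrow> 'm \<Rightarrow> 'm \<Rightarrow> ennreal" where
  "riem_dist M x y = (INF w \<in> {w. piecewise_C1_curve M w \<and> w 0 = x \<and> w 1 = y}. curve_length M w)"

definition riem_complete :: "('m::topological_space, 'n::finite, 'z) riem_scheme \<Rightarrow> bool" where
  "riem_complete M \<longleftrightarrow>
     (\<forall>X :: nat \<Rightarrow> 'm.
        (\<forall>e>0. \<exists>N. \<forall>i\<ge>N. \<forall>j\<ge>N. riem_dist M (X i) (X j) < e) \<longrightarrow>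
        (\<exists>x. (\<lambda>i. riem_dist M (X i) x) \<longlonglongrightarrow> 0))"

text \<open>The measure \<open>sqrt (det g) dx\<close>.  As countably many charts cover the manifold, exactly one
  Borel measure has this property.\<close>

definition riem_volume ::
    "('m::topological_space, 'n::finite, 'z) riem_scheme \<Rightarrow> 'm measure \<Rightarrow> bool" where
  "riem_volume M \<mu> \<longleftrightarrow> sets \<mu> = sets borel \<and>
     (\<forall>c\<in>charts M. \<forall>A\<in>sets borel. A \<subseteq> cdom c \<longrightarrow>
        emeasure \<mu> A =
          (\<integral>\<^sup>+ y \<in> cmap c ` A. ennreal (sqrt (det (gmat M c (cinv c y)))) \<partial>lborel))"

section \<open>Clifford modules and the spin group\<close>

definition hinner :: "complex ^ 's::finite \<Rightarrow> complex ^ 's \<Rightarrow> complex" where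
  "hinner v w = (\<Sum>a\<in>UNIV. v $ a * cnj (w $ a))"

text \<open>An irreducible complex Clifford module with skew-Hermitian generators; irreducibility is
  expressed by its dimension.\<close>

definition clifford_module :: "('n::finite \<Rightarrow> complex ^ 's ^ 's::finite) \<Rightarrow> bool" where
  "clifford_module \<gamma> \<longleftrightarrow> CARD('s) = 2 ^ (CARD('n) div 2) \<and>
     (\<forall>i j. \<gamma> i ** \<gamma> j + \<gamma> j ** \<gamma> i = mat (if i = j then - 2 else 0)) \<and>
     (\<forall>i a b. cnj (\<gamma> i $ b $ a) = - (\<gamma> i $ a $ b))"

definition cliff_vec :: "('n::finite \<Rightarrow> complex ^ 's ^ 's::finite) \<Rightarrow> real ^ 'n \<Rightarrow> complex ^ 's ^ 's" where
  "cliff_vec \<gamma> v = (\<Sum>i\<in>UNIV. v $ i *\<^sub>R \<gamma> i)"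

text \<open>Products of an even number of unit vectors.  The group is realised in the matrices of the
  spin representation, which is faithful on the even part of the real Clifford algebra.\<close>

inductive_set Spin :: "('n::finite \<Rightarrow> complex ^ 's ^ 's::finite) \<Rightarrow> (complex ^ 's ^ 's) set"
  for \<gamma> where
  one: "mat 1 \<in> Spin \<gamma>"
| mult: "A \<in> Spin \<gamma> \<Longrightarrow> norm v = 1 \<Longrightarrow> norm w = 1 \<Longrightarrow>
    cliff_vec \<gamma> v ** cliff_vec \<gamma> w ** A \<in> Spin \<gamma>"

text \<open>\<open>R\<close> is the image of \<open>A\<close> under the double covering of the special orthogonal group,
  \<open>A e\<^sub>j A\<inverse> = \<Sum>\<^sub>i R\<^sub>i\<^sub>j e\<^sub>i\<close>.\<close>

definition spin_covers ::
    "('n::finite \<Rightarrow> complex ^ 's ^ 's::finite) \<Rightarrow> complex ^ 's ^ 's \<Rightarrow> real ^ 'n ^ 'n \<Rightarrow> bool" where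
  "spin_covers \<gamma> A R \<longleftrightarrow> (\<forall>j. A ** \<gamma> j ** matrix_inv A = (\<Sum>i\<in>UNIV. R $ i $ j *\<^sub>R \<gamma> i))"

section \<open>Spin structures, spinors and the Dirac operator\<close>

text \<open>\<open>proj\<close> and \<open>act\<close> are the projection and the right action of the principal bundle of spin
  frames, with total space \<open>'p\<close>; \<open>frame\<close> is its map to the bundle of oriented orthonormal
  frames.\<close>

record ('m, 'n, 'p, 's) spin_mfd = "('m, 'n::finite) riem" +
  gam :: "'n \<Rightarrow> complex ^ 's::finite ^ 's"
  proj :: "'p \<Rightarrow> 'm"
  act :: "'p \<Rightarrow> complex ^ 's ^ 's \<Rightarrow> 'p"
  frame :: "'p \<Rightarrow> 'n \<Rightarrow> ('m, 'n) tangent"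

definition oriented_orthonormal_frame ::
    "('m, 'n::finite, 'z) riem_scheme \<Rightarrow> 'm \<Rightarrow> ('n \<Rightarrow> ('m, 'n) tangent) \<Rightarrow> bool" where
  "oriented_orthonormal_frame M x e \<longleftrightarrow>
     (\<forall>i. e i \<in> tangent_space M x) \<and>
     (\<forall>i j. ginner M x (e i) (e j) = (if i = j then 1 else 0)) \<and>
     (\<forall>c. is_chart_at M c x \<longrightarrow> det (\<chi> a i. e i c $ a) > 0)"

text \<open>The smooth structure of the total space is the one making the covering \<open>frame\<close> a local
  diffeomorphism.  Hence a continuous section is smooth iff the frame field it covers is.\<close>

definition smooth_section ::
    "('m::{t2_space, second_countable_topology}, 'n::finite, 'p::topological_space, 's::finite) spin_mfd
      \<Rightarrow> 'm set \<Rightarrow> ('m \<Rightarrow> 'p) \<Rightarrow> bool" where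
  "smooth_section M U s \<longleftrightarrow> open U \<and> continuous_on U s \<and> (\<forall>x\<in>U. proj M (s x) = x) \<and>
     (\<forall>c\<in>charts M. \<forall>i. smooth_on (cmap c ` (U \<inter> cdom c)) (\<lambda>y. frame M (s (cinv c y)) i c))"

definition spin_structure ::
    "('m::{t2_space, second_countable_topology}, 'n::finite, 'p::topological_space, 's::finite) spin_mfd
      \<Rightarrow> bool" where
  "spin_structure M \<longleftrightarrow>
     clifford_module (gam M) \<and>
     continuous_on UNIV (proj M) \<and>
     continuous_on (UNIV \<times> Spin (gam M)) (\<lambda>(p, A). act M p A) \<and>
     (\<forall>p. act M p (mat 1) = p) \<and>
     (\<forall>p. \<forall>A\<in>Spin (gam M). \<forall>B\<in>Spin (gam M). act M (act M p A) B = act M p (A ** B)) \<and>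
     (\<forall>p. \<forall>A\<in>Spin (gam M). proj M (act M p A) = proj M p) \<and>
     (\<forall>p q. proj M p = proj M q \<longrightarrow> (\<exists>!A. A \<in> Spin (gam M) \<and> q = act M p A)) \<and>
     (\<forall>x. \<exists>U s. x \<in> U \<and> smooth_section M U s \<and>
        (\<exists>h. homeomorphism (U \<times> Spin (gam M)) (proj M -` U) (\<lambda>(y, A). act M (s y) A) h)) \<and>
     (\<forall>p. oriented_orthonormal_frame M (proj M p) (frame M p)) \<and>
     (\<forall>p. \<forall>A\<in>Spin (gam M). \<forall>R. spin_covers (gam M) A R \<longrightarrow>
        (\<forall>j c. frame M (act M p A) j c = (\<Sum>i\<in>UNIV. R $ i $ j *\<^sub>R frame M p i c)))"

definition riemannian_spin_manifold ::
    "('m::{t2_space, second_countable_topology}, 'n::finite, 'p::topological_space, 's::finite) spin_mfd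
      \<Rightarrow> bool" where
  "riemannian_spin_manifold M \<longleftrightarrow> oriented_riemannian_manifold M \<and> spin_structure M"

text \<open>Sections of the spinor bundle, i.e. of the bundle associated with the spin representation,
  as equivariant functions on the spin frames.\<close>

definition spinor ::
    "('m, 'n::finite, 'p, 's::finite) spin_mfd \<Rightarrow> ('p \<Rightarrow> complex ^ 's) \<Rightarrow> bool" where
  "spinor M \<psi> \<longleftrightarrow> (\<forall>p. \<forall>A\<in>Spin (gam M). \<psi> (act M p A) = matrix_inv A *v \<psi> p)"

definition Ck_spinor ::
    "nat \<Rightarrow> ('m::{t2_space, second_countable_topology}, 'n::finite, 'p::topological_space, 's::finite) spin_mfd
      \<Rightarrow> ('p \<Rightarrow> complex ^ 's) \<Rightarrow> bool" where
  "Ck_spinor k M \<psi> \<longleftrightarrow> spinor M \<psi> \<and>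
     (\<forall>U s. smooth_section M U s \<longrightarrow>
        (\<forall>c\<in>charts M. Ck_on k (cmap c ` (U \<inter> cdom c)) (\<psi> \<circ> s \<circ> cinv c)))"

text \<open>Clifford multiplication of a spinor value \<open>w\<close> at the spin frame \<open>p\<close> by a tangent vector.\<close>

definition cliff ::
    "('m, 'n::finite, 'p, 's::finite) spin_mfd \<Rightarrow> 'p \<Rightarrow> ('m, 'n) tangent \<Rightarrow> complex ^ 's
      \<Rightarrow> complex ^ 's" where
  "cliff M p X w = cliff_vec (gam M) (\<chi> k. ginner M (proj M p) X (frame M p k)) *v w"

text \<open>The local formula
  \<open>\<nabla>\<^sub>v \<psi> = v(\<psi>) + 1/4 \<Sum>\<^sub>j\<^sub>k g(\<nabla>\<^sub>v e\<^sub>j, e\<^sub>k) e\<^sub>j \<cdot> e\<^sub>k \<cdot> \<psi>\<close> for the connection induced by the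
  Levi-Civita connection, in the trivialisation by a local section \<open>s\<close> of the spin frames that
  covers the frame \<open>e\<close>.\<close>

definition local_spin_connection ::
    "('m, 'n::finite, 'p, 's::finite) spin_mfd \<Rightarrow> ('m \<Rightarrow> 'p) \<Rightarrow> ('p \<Rightarrow> complex ^ 's)
      \<Rightarrow> 'm \<Rightarrow> ('m, 'n) tangent \<Rightarrow> complex ^ 's" where
  "local_spin_connection M s \<psi> x v =
     (let c = chart_at M x; e = (\<lambda>j y. frame M (s y) j)
      in directional c x (v c) (\<psi> \<circ> s) +
         (1/4) *\<^sub>R (\<Sum>j\<in>UNIV. \<Sum>k\<in>UNIV.
            ginner M x (levi_civita M x v (e j)) (e k x) *\<^sub>R
              (gam M j *v (gam M k *v \<psi> (s x)))))"

text \<open>A section through \<open>p\<close> is chosen; the covariant derivative does not depend on the choice.\<close>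

definition section_at ::
    "('m::{t2_space, second_countable_topology}, 'n::finite, 'p::topological_space, 's::finite) spin_mfd
      \<Rightarrow> 'p \<Rightarrow> ('m \<Rightarrow> 'p)" where
  "section_at M p = (SOME s. \<exists>U. proj M p \<in> U \<and> smooth_section M U s \<and> s (proj M p) = p)"

definition nabla ::
    "('m::{t2_space, second_countable_topology}, 'n::finite, 'p::topological_space, 's::finite) spin_mfd
      \<Rightarrow> ('p \<Rightarrow> complex ^ 's) \<Rightarrow> 'p \<Rightarrow> ('m, 'n) tangent \<Rightarrow> complex ^ 's" where
  "nabla M \<psi> p v = local_spin_connection M (section_at M p) \<psi> (proj M p) v"

definition dirac ::
    "('m::{t2_space, second_countable_topology}, 'n::finite, 'p::topological_space, 's::finite) spin_mfd
      \<Rightarrow> ('p \<Rightarrow> complex ^ 's) \<Rightarrow> 'p \<Rightarrow> complex ^ 's" where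
  "dirac M \<psi> p = (\<Sum>i\<in>UNIV. cliff M p (frame M p i) (nabla M \<psi> p (frame M p i)))"

definition weighted_dirac ::
    "('m::{t2_space, second_countable_topology}, 'n::finite, 'p::topological_space, 's::finite) spin_mfd
      \<Rightarrow> ('m \<Rightarrow> real) \<Rightarrow> ('p \<Rightarrow> complex ^ 's) \<Rightarrow> 'p \<Rightarrow> complex ^ 's" where
  "weighted_dirac M f \<psi> p =
     dirac M \<psi> p - (1/2) *\<^sub>R cliff M p (grad M f (proj M p)) (\<psi> p)"

definition U_weight ::
    "('m, 'n::finite, 'p, 's::finite) spin_mfd \<Rightarrow> ('m \<Rightarrow> real) \<Rightarrow> ('p \<Rightarrow> complex ^ 's)
      \<Rightarrow> 'p \<Rightarrow> complex ^ 's" where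
  "U_weight M f \<psi> p = exp (f (proj M p) / 2) *\<^sub>R \<psi> p"

section \<open>Unbounded operators on Hilbert spaces\<close>

record 'h hilbert =
  hcarrier :: "'h set"
  hadd :: "'h \<Rightarrow> 'h \<Rightarrow> 'h"
  hscale :: "complex \<Rightarrow> 'h \<Rightarrow> 'h"
  hprod :: "'h \<Rightarrow> 'h \<Rightarrow> complex"

definition hnorm :: "'h hilbert \<Rightarrow> 'h \<Rightarrow> real" where
  "hnorm H x = sqrt (Re (hprod H x x))"

definition hdiff :: "'h hilbert \<Rightarrow> 'h \<Rightarrow> 'h \<Rightarrow> 'h" where
  "hdiff H x y = hadd H x (hscale H (- 1) y)"

definition unitary :: "'h hilbert \<Rightarrow> 'k hilbert \<Rightarrow> ('h \<Rightarrow> 'k) \<Rightarrow> bool" where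
  "unitary H K U \<longleftrightarrow> bij_betw U (hcarrier H) (hcarrier K) \<and>
     (\<forall>x\<in>hcarrier H. \<forall>y\<in>hcarrier H. U (hadd H x y) = hadd K (U x) (U y)) \<and>
     (\<forall>a. \<forall>x\<in>hcarrier H. U (hscale H a x) = hscale K a (U x)) \<and>
     (\<forall>x\<in>hcarrier H. \<forall>y\<in>hcarrier H. hprod K (U x) (U y) = hprod H x y)"

text \<open>Operators are given by their graphs \<open>A\<close>; the domain of definition is \<open>Domain A\<close>, and
  \<open>A `` {x}\<close> is the singleton of the value at \<open>x\<close>.\<close>

definition unitarily_equivalent ::
    "'h hilbert \<Rightarrow> ('h \<times> 'h) set \<Rightarrow> 'k hilbert \<Rightarrow> ('k \<times> 'k) set \<Rightarrow> bool" where
  "unitarily_equivalent H A K B \<longleftrightarrow> (\<exists>U. unitary H K U \<and> U ` Domain A = Domain B \<and>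
     (\<forall>x\<in>Domain B. U ` (A `` {inv_into (hcarrier H) U x}) = B `` {x}))"

definition closure_op :: "'h hilbert \<Rightarrow> ('h \<times> 'h) set \<Rightarrow> ('h \<times> 'h) set" where
  "closure_op H A = {(x, y). x \<in> hcarrier H \<and> y \<in> hcarrier H \<and>
     (\<exists>X Y. (\<forall>i::nat. (X i, Y i) \<in> A) \<and>
        (\<lambda>i. hnorm H (hdiff H (X i) x)) \<longlonglongrightarrow> 0 \<and> (\<lambda>i. hnorm H (hdiff H (Y i) y)) \<longlonglongrightarrow> 0)}"

definition resolvent_set :: "'h hilbert \<Rightarrow> ('h \<times> 'h) set \<Rightarrow> complex set" where
  "resolvent_set H A = {l.
     (\<forall>y\<in>hcarrier H. \<exists>!x. \<exists>z. (x, z) \<in> A \<and> hdiff H z (hscale H l x) = y) \<and>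
     (\<exists>C. \<forall>(x, z)\<in>A. hnorm H x \<le> C * hnorm H (hdiff H z (hscale H l x)))}"

definition spectrum :: "'h hilbert \<Rightarrow> ('h \<times> 'h) set \<Rightarrow> complex set" where
  "spectrum H A = - resolvent_set H A"

definition isospectral ::
    "'h hilbert \<Rightarrow> ('h \<times> 'h) set \<Rightarrow> 'k hilbert \<Rightarrow> ('k \<times> 'k) set \<Rightarrow> bool" where
  "isospectral H A K B \<longleftrightarrow> spectrum H A = spectrum K B"

section \<open>Square-integrable spinors\<close>

definition measurable_spinor ::
    "('m::{t2_space, second_countable_topology}, 'n::finite, 'p::topological_space, 's::finite) spin_mfd
      \<Rightarrow> ('p \<Rightarrow> complex ^ 's) \<Rightarrow> bool" where
  "measurable_spinor M \<psi> \<longleftrightarrow> spinor M \<psi> \<and>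
     (\<forall>U s. smooth_section M U s \<longrightarrow> \<psi> \<circ> s \<in> borel_measurable (restrict_space borel U))"

text \<open>The pointwise Hermitian product; as the spin group acts unitarily, every spin frame over the
  point gives the same value.\<close>

definition pairing ::
    "('m, 'n::finite, 'p, 's::finite) spin_mfd \<Rightarrow> ('p \<Rightarrow> complex ^ 's) \<Rightarrow> ('p \<Rightarrow> complex ^ 's)
      \<Rightarrow> 'm \<Rightarrow> complex" where
  "pairing M \<psi> \<phi> x = (let p = (SOME p. proj M p = x) in hinner (\<psi> p) (\<phi> p))"

definition L2_fun ::
    "('m::{t2_space, second_countable_topology}, 'n::finite, 'p::topological_space, 's::finite) spin_mfd
      \<Rightarrow> 'm measure \<Rightarrow> ('p \<Rightarrow> complex ^ 's) set" where
  "L2_fun M \<mu> = {\<psi>. measurable_spinor M \<psi> \<and> integrable \<mu> (\<lambda>x. Re (pairing M \<psi> \<psi> x))}"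

definition L2_rel ::
    "('m::{t2_space, second_countable_topology}, 'n::finite, 'p::topological_space, 's::finite) spin_mfd
      \<Rightarrow> 'm measure \<Rightarrow> (('p \<Rightarrow> complex ^ 's) \<times> ('p \<Rightarrow> complex ^ 's)) set" where
  "L2_rel M \<mu> = {(\<psi>, \<phi>). \<psi> \<in> L2_fun M \<mu> \<and> \<phi> \<in> L2_fun M \<mu> \<and>
     (AE x in \<mu>. \<forall>p. proj M p = x \<longrightarrow> \<psi> p = \<phi> p)}"

definition L2_class ::
    "('m::{t2_space, second_countable_topology}, 'n::finite, 'p::topological_space, 's::finite) spin_mfd
      \<Rightarrow> 'm measure \<Rightarrow> ('p \<Rightarrow> complex ^ 's) \<Rightarrow> ('p \<Rightarrow> complex ^ 's) set" where
  "L2_class M \<mu> \<psi> = L2_rel M \<mu> `` {\<psi>}"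

abbreviation repr :: "'a set \<Rightarrow> 'a" where "repr X \<equiv> (SOME \<psi>. \<psi> \<in> X)"

definition L2 ::
    "('m::{t2_space, second_countable_topology}, 'n::finite, 'p::topological_space, 's::finite) spin_mfd
      \<Rightarrow> 'm measure \<Rightarrow> ('p \<Rightarrow> complex ^ 's) set hilbert" where
  "L2 M \<mu> = \<lparr>
     hcarrier = L2_fun M \<mu> // L2_rel M \<mu>,
     hadd = (\<lambda>X Y. L2_class M \<mu> (\<lambda>p. repr X p + repr Y p)),
     hscale = (\<lambda>a X. L2_class M \<mu> (\<lambda>p. a *s repr X p)),
     hprod = (\<lambda>X Y. \<integral>x. pairing M (repr X) (repr Y) x \<partial>\<mu>)\<rparr>"

definition weighted_measure :: "'m measure \<Rightarrow> ('m \<Rightarrow> real) \<Rightarrow> 'm measure" where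
  "weighted_measure \<mu> f = density \<mu> (\<lambda>x. ennreal (exp (- f x)))"

definition test_spinor ::
    "('m::{t2_space, second_countable_topology}, 'n::finite, 'p::topological_space, 's::finite) spin_mfd
      \<Rightarrow> ('p \<Rightarrow> complex ^ 's) \<Rightarrow> bool" where
  "test_spinor M \<psi> \<longleftrightarrow> (\<forall>k. Ck_spinor k M \<psi>) \<and> compact (closure {proj M p |p. \<psi> p \<noteq> 0})"

text \<open>The operator in \<open>L\<^sup>2\<close> given by a differential expression \<open>T\<close> on spinors: the closure of \<open>T\<close> on
  smooth compactly supported spinors.  On a complete manifold the Dirac operator is essentially
  self-adjoint on this core, so its closure is its only self-adjoint extension.\<close>

definition L2_operator ::
    "('m::{t2_space, second_countable_topology}, 'n::finite, 'p::topological_space, 's::finite) spin_mfd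
      \<Rightarrow> 'm measure \<Rightarrow> (('p \<Rightarrow> complex ^ 's) \<Rightarrow> ('p \<Rightarrow> complex ^ 's))
      \<Rightarrow> (('p \<Rightarrow> complex ^ 's) set \<times> ('p \<Rightarrow> complex ^ 's) set) set" where
  "L2_operator M \<mu> T = closure_op (L2 M \<mu>)
     {(L2_class M \<mu> \<psi>, L2_class M \<mu> (T \<psi>)) |\<psi>.
        test_spinor M \<psi> \<and> \<psi> \<in> L2_fun M \<mu> \<and> T \<psi> \<in> L2_fun M \<mu>}"

definition dirac_op ::
    "('m::{t2_space, second_countable_topology}, 'n::finite, 'p::topological_space, 's::finite) spin_mfd
      \<Rightarrow> 'm measure \<Rightarrow> (('p \<Rightarrow> complex ^ 's) set \<times> ('p \<Rightarrow> complex ^ 's) set) set" where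
  "dirac_op M \<mu> = L2_operator M \<mu> (dirac M)"

definition weighted_dirac_op ::
    "('m::{t2_space, second_countable_topology}, 'n::finite, 'p::topological_space, 's::finite) spin_mfd
      \<Rightarrow> 'm measure \<Rightarrow> ('m \<Rightarrow> real)
      \<Rightarrow> (('p \<Rightarrow> complex ^ 's) set \<times> ('p \<Rightarrow> complex ^ 's) set) set" where
  "weighted_dirac_op M \<mu> f = L2_operator M (weighted_measure \<mu> f) (weighted_dirac M f)"

end

theory Submission
  imports Defs
begin

text \<open>
  Both operators are conjugate for a pointwise reason.  The Leibniz rule
  \<open>\<nabla>\<^sub>v (h \<psi>) = h \<nabla>\<^sub>v \<psi> + v(h) \<psi>\<close> for \<open>C\<^sup>1\<close> spinors gives \<open>D(h \<psi>) = h D\<psi> + \<nabla>h \<cdot> \<psi>\<close>; for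
  \<open>h = exp (f/2)\<close> the additional term is \<open>exp (f/2)\<close> times \<open>1/2 \<nabla>f \<cdot> \<psi>\<close>, which is exactly what
  \<open>D\<^sub>f\<close> subtracts.  Thus \<open>D\<^sub>f (U\<^sub>f \<psi>) = U\<^sub>f (D \<psi>)\<close> (\<open>weighted_dirac_U_weight\<close>), and the
  statements about \<open>C\<^sup>1\<close> spinors follow by replacing \<open>\<psi>\<close> with \<open>U\<^sub>-\<^sub>f \<psi>\<close> and by the injectivity of
  \<open>U\<^sub>f\<close>.

  The covariant derivative is computed in the trivialisation by a chosen section of the spin frames
  through a given frame, so the computation depends on the existence of a smooth such section.  A
  local section exists by local triviality and is moved to the given frame by an element \<open>A\<close> of the
  spin group; the moved section is smooth because the frame field below it is rotated by a constant
  matrix.  This requires that conjugation by \<open>A\<close> maps vectors to vectors, which holds since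
  conjugation by a unit vector is, up to sign, a reflection (\<open>Spin_isometry_preserving_vectors\<close>).

  On square-integrable spinors \<open>U\<^sub>f\<close> acts on equivalence classes by taking images.  As
  \<open>\<langle>U\<^sub>f \<psi>, U\<^sub>f \<phi>\<rangle> = exp f \<langle>\<psi>, \<phi>\<rangle>\<close> pointwise, the factor cancels against the density
  \<open>exp (- f)\<close>, and the map is unitary (\<open>unitary_U_weight\<close>).  It maps smooth compactly supported
  spinors onto themselves and there intertwines the two differential expressions; a unitary map
  carries the closure of a graph to the closure of its image (\<open>closure_op_unitary_image\<close>), hence one
  operator onto the other.  Equality of the spectra is then a general fact on such pairs.
\<close>

section \<open>Calculus of maps of class C^k\<close>

text \<open>The derivatives in \<open>Ck_on\<close> are two-sided, so on an open set they only see the values there.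
  Spinors in a local trivialisation obey the product formula only over the domain of the section,
  and this is how the formula is differentiated.\<close>

lemma frechet_derivative_cong_on_open:
  assumes "open S" "x \<in> S" "\<And>y. y \<in> S \<Longrightarrow> g y = h y" "g differentiable (at x)"
  shows "h differentiable (at x)" "frechet_derivative h (at x) = frechet_derivative g (at x)"
proof -
  have "(h has_derivative frechet_derivative g (at x)) (at x)"
    using assms(4)[unfolded frechet_derivative_works]
    by (rule has_derivative_transform_within_open) (use assms in auto)
  then show "h differentiable (at x)" "frechet_derivative h (at x) = frechet_derivative g (at x)"
    by (auto simp: differentiable_def dest: frechet_derivative_at)
qed

lemma Ck_on_cong:
  assumes "open S" "\<And>x. x \<in> S \<Longrightarrow> g x = h x" "Ck_on k S g"
  shows "Ck_on k S h"
  using assms(2,3)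
proof (induction k arbitrary: g h)
  case 0
  then show ?case by (simp cong: continuous_on_cong)
next
  case (Suc k)
  have eq: "h differentiable (at x)" "frechet_derivative h (at x) = frechet_derivative g (at x)"
    if "x \<in> S" for x
    using frechet_derivative_cong_on_open[OF assms(1) that, of g h] Suc.prems that by auto
  have "Ck_on k S (\<lambda>x. frechet_derivative h (at x) b)" if "b \<in> Basis" for b
    by (rule Suc.IH[of "\<lambda>x. frechet_derivative g (at x) b"]) (use eq Suc.prems that in auto)
  with eq show ?case by auto
qed

lemma Ck_on_subset: "Ck_on k S h \<Longrightarrow> T \<subseteq> S \<Longrightarrow> Ck_on k T h"
  by (induction k arbitrary: h) (auto intro: continuous_on_subset)

lemma Ck_on_Suc_imp: "Ck_on (Suc k) S h \<Longrightarrow> Ck_on k S h"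
proof (induction k arbitrary: h)
  case 0
  then show ?case
    by (simp add: continuous_at_imp_continuous_on differentiable_imp_continuous_within)
next
  case (Suc k)
  then show ?case by (simp del: Ck_on.simps(2) add: Ck_on.simps(2)[of _ S])
qed

lemma Ck_on_const: "Ck_on k S (\<lambda>x. c)"
  by (induction k arbitrary: c) auto

lemma frechet_derivative_add_fun:
  assumes "g differentiable (at x)" "h differentiable (at x)"
  shows "frechet_derivative (\<lambda>x. g x + h x) (at x) v =
    frechet_derivative g (at x) v + frechet_derivative h (at x) v"
proof -
  have "((\<lambda>x. g x + h x) has_derivative
      (\<lambda>v. frechet_derivative g (at x) v + frechet_derivative h (at x) v)) (at x)"
    using assms by (intro has_derivative_add) (simp_all add: frechet_derivative_works[symmetric])
  from frechet_derivative_at[OF this] show ?thesis by metis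
qed

lemma Ck_on_add:
  assumes "open S" "Ck_on k S g" "Ck_on k S h"
  shows "Ck_on k S (\<lambda>x. g x + h x)"
  using assms(2,3)
proof (induction k arbitrary: g h)
  case 0
  then show ?case by (simp, intro continuous_intros)
next
  case (Suc k)
  have "Ck_on k S (\<lambda>x. frechet_derivative (\<lambda>x. g x + h x) (at x) b)" if "b \<in> Basis" for b
    by (rule Ck_on_cong[OF assms(1), of "\<lambda>x. frechet_derivative g (at x) b + frechet_derivative h (at x) b"])
      (use Suc that in \<open>auto simp: frechet_derivative_add_fun\<close>)
  with Suc.prems show ?case by auto
qed

lemma frechet_derivative_scaleR_fun:
  assumes "a differentiable (at x)" "h differentiable (at x)"
  shows "(\<lambda>x. a x *\<^sub>R h x) differentiable (at x)"
    and "frechet_derivative (\<lambda>x. a x *\<^sub>R h x) (at x) v =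
    a x *\<^sub>R frechet_derivative h (at x) v + frechet_derivative a (at x) v *\<^sub>R h x"
    (is "_ = ?D v")
proof -
  have "((\<lambda>x. a x *\<^sub>R h x) has_derivative ?D) (at x)"
    using assms by (intro has_derivative_scaleR) (simp_all add: frechet_derivative_works[symmetric])
  from frechet_derivative_at[OF this] differentiableI[OF this]
  show "(\<lambda>x. a x *\<^sub>R h x) differentiable (at x)"
    and "frechet_derivative (\<lambda>x. a x *\<^sub>R h x) (at x) v = ?D v" by metis+
qed

text \<open>By the Leibniz rule, each partial derivative is a sum of two products; the induction
  hypothesis applies to them because the undifferentiated factor of each product is also of
  class \<open>k\<close>.\<close>

lemma Ck_on_scaleR:
  assumes "open S" "Ck_on k S a" "Ck_on k S h"
  shows "Ck_on k S (\<lambda>x. a x *\<^sub>R h x)"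
  using assms(2,3)
proof (induction k arbitrary: a h)
  case 0
  then show ?case by (simp, intro continuous_intros)
next
  case (Suc k)
  have "Ck_on k S (\<lambda>x. frechet_derivative (\<lambda>x. a x *\<^sub>R h x) (at x) b)" if "b \<in> Basis" for b
  proof (rule Ck_on_cong[OF assms(1)])
    show "Ck_on k S (\<lambda>x. a x *\<^sub>R frechet_derivative h (at x) b
        + frechet_derivative a (at x) b *\<^sub>R h x)"
      using Suc.prems that
      by (intro Ck_on_add[OF assms(1)] Suc.IH) (auto intro: Ck_on_Suc_imp)
  qed (use Suc.prems in \<open>auto simp: frechet_derivative_scaleR_fun\<close>)
  with Suc.prems show ?case by auto
qed

lemma Ck_on_sum:
  assumes "open S" "finite I" "\<And>i. i \<in> I \<Longrightarrow> Ck_on k S (h i)"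
  shows "Ck_on k S (\<lambda>x. \<Sum>i\<in>I. h i x)"
  using assms(2,3) by (induction I rule: finite_induct) (auto simp: Ck_on_const Ck_on_add assms(1))

lemma frechet_derivative_exp_half:
  fixes a :: "'a::euclidean_space \<Rightarrow> real"
  assumes "a differentiable (at x)"
  shows "(\<lambda>x. exp (a x / 2)) differentiable (at x)"
    "frechet_derivative (\<lambda>x. exp (a x / 2)) (at x) v =
      exp (a x / 2) *\<^sub>R ((1/2) *\<^sub>R frechet_derivative a (at x) v)"
proof -
  have "((\<lambda>x. exp (a x / 2)) has_derivative
      (\<lambda>v. exp (a x / 2) *\<^sub>R ((1/2) *\<^sub>R frechet_derivative a (at x) v))) (at x)"
    using assms[unfolded frechet_derivative_works]
    by (auto intro!: derivative_eq_intros simp: field_simps)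
  then show "(\<lambda>x. exp (a x / 2)) differentiable (at x)"
    "frechet_derivative (\<lambda>x. exp (a x / 2)) (at x) v =
      exp (a x / 2) *\<^sub>R ((1/2) *\<^sub>R frechet_derivative a (at x) v)"
    by (auto simp: differentiable_def dest: frechet_derivative_at[symmetric])
qed

lemma Ck_on_exp_half:
  fixes a :: "'a::euclidean_space \<Rightarrow> real"
  assumes "open S" "Ck_on k S a"
  shows "Ck_on k S (\<lambda>x. exp (a x / 2))"
  using assms(2)
proof (induction k)
  case 0
  then show ?case by (simp, intro continuous_intros) simp_all
next
  case (Suc k)
  have "Ck_on k S (\<lambda>x. frechet_derivative (\<lambda>x. exp (a x / 2)) (at x) b)" if "b \<in> Basis" for b
  proof (rule Ck_on_cong[OF assms(1)])
    show "Ck_on k S (\<lambda>x. exp (a x / 2) *\<^sub>R ((1/2) *\<^sub>R frechet_derivative a (at x) b))"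
      using Ck_on_Suc_imp[OF Suc.prems] Suc that
      by (intro Ck_on_scaleR[OF assms(1)] Ck_on_const) auto
  qed (use Suc.prems in \<open>auto simp: frechet_derivative_exp_half\<close>)
  with Suc.prems show ?case by (auto simp: frechet_derivative_exp_half)
qed

section \<open>The spin group acts by isometries and preserves vectors\<close>

lemma matrix_mult_scaleR_left: "(r *\<^sub>R A) ** B = r *\<^sub>R (A ** B)"
  for A B :: "complex ^ 's ^ 's::finite"
  by (simp add: matrix_matrix_mult_def vec_eq_iff scaleR_sum_right)

lemma matrix_mult_scaleR_right: "A ** (r *\<^sub>R B) = r *\<^sub>R (A ** B)"
  for A B :: "complex ^ 's ^ 's::finite"
  by (simp add: matrix_matrix_mult_def vec_eq_iff scaleR_sum_right)

lemma matrix_mult_sum_left: "(\<Sum>i\<in>I. h i) ** B = (\<Sum>i\<in>I. h i ** B)"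
  for B :: "complex ^ 's ^ 's::finite"
  by (simp add: matrix_matrix_mult_def vec_eq_iff sum_distrib_right)
    (intro allI, rule sum.swap)

lemma matrix_mult_sum_right: "B ** (\<Sum>i\<in>I. h i) = (\<Sum>i\<in>I. B ** h i)"
  for B :: "complex ^ 's ^ 's::finite"
  by (simp add: matrix_matrix_mult_def vec_eq_iff sum_distrib_left)
    (intro allI, rule sum.swap)

lemma matrix_mult_diff_left: "(A - B) ** C = A ** C - B ** C"
  for A B C :: "complex ^ 's ^ 's::finite"
  by (simp add: matrix_matrix_mult_def vec_eq_iff left_diff_distrib sum_subtractf)

lemma matrix_inv_eqI:
  fixes A B :: "complex ^ 's ^ 's::finite"
  assumes "A ** B = mat 1" "B ** A = mat 1"
  shows "matrix_inv A = B"
proof -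
  have "A ** matrix_inv A = mat 1 \<and> matrix_inv A ** A = mat 1"
    unfolding matrix_inv_def
    by (rule someI[where P = "\<lambda>B. A ** B = mat 1 \<and> B ** A = mat 1" and x = B]) (simp add: assms)
  then have "B ** (A ** matrix_inv A) = B" by simp
  then show ?thesis by (simp add: matrix_mul_assoc assms)
qed

lemma cliff_vec_axis: "cliff_vec \<gamma> (axis j 1) = \<gamma> j"
proof -
  have "cliff_vec \<gamma> (axis j 1) = (\<Sum>i\<in>UNIV. if i = j then \<gamma> i else 0)"
    unfolding cliff_vec_def by (rule sum.cong) (auto simp: axis_def)
  then show ?thesis by simp
qed

lemma cliff_vec_diff_scaleR: "cliff_vec \<gamma> (a *\<^sub>R u - b *\<^sub>R v) = a *\<^sub>R cliff_vec \<gamma> u - b *\<^sub>R cliff_vec \<gamma> v"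
  by (simp add: cliff_vec_def scaleR_sum_right sum_subtractf algebra_simps)

text \<open>Polarised form of \<open>v \<cdot> v = - |v|\<^sup>2\<close>, from the relations between the generators by
  bilinearity.\<close>

lemma cliff_vec_anticommute:
  assumes "clifford_module \<gamma>"
  shows "cliff_vec \<gamma> u ** cliff_vec \<gamma> v + cliff_vec \<gamma> v ** cliff_vec \<gamma> u = (- 2 * (u \<bullet> v)) *\<^sub>R mat 1"
proof -
  have "\<gamma> i ** \<gamma> j + \<gamma> j ** \<gamma> i = mat (if i = j then - 2 else 0)" for i j
    using assms unfolding clifford_module_def by blast
  then have rel: "\<gamma> i ** \<gamma> j + \<gamma> j ** \<gamma> i = (if i = j then - 2 else 0) *\<^sub>R mat 1" for i j
    by (simp add: mat_def vec_eq_iff scaleR_conv_of_real)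
  have expand: "cliff_vec \<gamma> x ** cliff_vec \<gamma> y = (\<Sum>i\<in>UNIV. \<Sum>j\<in>UNIV. (x $ i * y $ j) *\<^sub>R (\<gamma> i ** \<gamma> j))" for x y
    unfolding cliff_vec_def matrix_mult_sum_left
    by (simp add: matrix_mult_sum_right matrix_mult_scaleR_left matrix_mult_scaleR_right scaleR_sum_right
        mult.commute)
  have "cliff_vec \<gamma> u ** cliff_vec \<gamma> v + cliff_vec \<gamma> v ** cliff_vec \<gamma> u =
      (\<Sum>i\<in>UNIV. \<Sum>j\<in>UNIV. (u $ i * v $ j) *\<^sub>R (\<gamma> i ** \<gamma> j))
      + (\<Sum>i\<in>UNIV. \<Sum>j\<in>UNIV. (v $ i * u $ j) *\<^sub>R (\<gamma> i ** \<gamma> j))"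
    by (simp only: expand)
  also have "(\<Sum>i\<in>UNIV. \<Sum>j\<in>UNIV. (v $ i * u $ j) *\<^sub>R (\<gamma> i ** \<gamma> j))
      = (\<Sum>i\<in>UNIV. \<Sum>j\<in>UNIV. (u $ i * v $ j) *\<^sub>R (\<gamma> j ** \<gamma> i))"
    unfolding sum.swap[of "\<lambda>i j. (v $ i * u $ j) *\<^sub>R (\<gamma> i ** \<gamma> j)"] by (simp only: mult.commute)
  also have "(\<Sum>i\<in>UNIV. \<Sum>j\<in>UNIV. (u $ i * v $ j) *\<^sub>R (\<gamma> i ** \<gamma> j)) + \<dots>
      = (\<Sum>i\<in>UNIV. \<Sum>j\<in>UNIV. (u $ i * v $ j) *\<^sub>R (\<gamma> i ** \<gamma> j + \<gamma> j ** \<gamma> i))"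
    by (simp add: sum.distrib scaleR_add_right)
  also have "\<dots> = (\<Sum>i\<in>UNIV. \<Sum>j\<in>UNIV. if i = j then (- 2 * (u $ i * v $ j)) *\<^sub>R mat 1 else 0)"
    unfolding rel by (intro sum.cong refl) auto
  also have "\<dots> = (- 2 * (u \<bullet> v)) *\<^sub>R mat 1"
    by (simp add: inner_vec_def sum_distrib_left scaleR_sum_left sum_negf)
  finally show ?thesis .
qed

lemma cliff_vec_square:
  assumes "clifford_module \<gamma>" "norm v = 1"
  shows "cliff_vec \<gamma> v ** cliff_vec \<gamma> v = - mat 1"
proof -
  have "2 *\<^sub>R (cliff_vec \<gamma> v ** cliff_vec \<gamma> v) = 2 *\<^sub>R (- mat 1)"
    using cliff_vec_anticommute[OF assms(1), of v v] assms(2)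
    by (simp add: scaleR_2 dot_square_norm)
  then show ?thesis by (simp only: scaleR_cancel_left) simp
qed

text \<open>By anticommutation \<open>v u v = - u v v - 2 \<langle>v, u\<rangle> v = u - 2 \<langle>v, u\<rangle> v\<close>, the reflection in
  the hyperplane orthogonal to \<open>v\<close>.\<close>

lemma cliff_vec_reflection:
  assumes "clifford_module \<gamma>" "norm v = 1"
  shows "cliff_vec \<gamma> v ** cliff_vec \<gamma> u ** cliff_vec \<gamma> v = cliff_vec \<gamma> (1 *\<^sub>R u - (2 * (v \<bullet> u)) *\<^sub>R v)"
proof -
  have "cliff_vec \<gamma> v ** cliff_vec \<gamma> u = (- 2 * (v \<bullet> u)) *\<^sub>R mat 1 - cliff_vec \<gamma> u ** cliff_vec \<gamma> v"
    using cliff_vec_anticommute[OF assms(1), of v u] by (simp add: algebra_simps)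
  then have "cliff_vec \<gamma> v ** cliff_vec \<gamma> u ** cliff_vec \<gamma> v =
      (- 2 * (v \<bullet> u)) *\<^sub>R cliff_vec \<gamma> v - cliff_vec \<gamma> u ** (cliff_vec \<gamma> v ** cliff_vec \<gamma> v)"
    by (simp only: matrix_mult_diff_left matrix_mult_scaleR_left matrix_mul_assoc matrix_mul_lid)
  also have "cliff_vec \<gamma> u ** (cliff_vec \<gamma> v ** cliff_vec \<gamma> v) = - cliff_vec \<gamma> u"
    using matrix_mult_scaleR_right[of "cliff_vec \<gamma> u" "-1" "mat 1"]
    by (simp add: cliff_vec_square[OF assms])
  finally show ?thesis by (simp only: cliff_vec_diff_scaleR) simp
qed

lemma hinner_cliff_vec:
  assumes "clifford_module \<gamma>"
  shows "hinner (cliff_vec \<gamma> u *v v) w = - hinner v (cliff_vec \<gamma> u *v w)"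
proof -
  have skew: "cnj (cliff_vec \<gamma> u $ b $ a) = - (cliff_vec \<gamma> u $ a $ b)" for a b
    using assms by (simp add: clifford_module_def cliff_vec_def sum_negf)
  have "hinner v (cliff_vec \<gamma> u *v w) = (\<Sum>b\<in>UNIV. \<Sum>a\<in>UNIV. v $ b * (cnj (cliff_vec \<gamma> u $ b $ a) * cnj (w $ a)))"
    by (simp add: hinner_def matrix_vector_mult_def sum_distrib_left)
  also have "\<dots> = - (\<Sum>b\<in>UNIV. \<Sum>a\<in>UNIV. v $ b * (cliff_vec \<gamma> u $ a $ b * cnj (w $ a)))"
    by (simp add: skew sum_negf)
  also have "(\<Sum>b\<in>UNIV. \<Sum>a\<in>UNIV. v $ b * (cliff_vec \<gamma> u $ a $ b * cnj (w $ a)))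
     = hinner (cliff_vec \<gamma> u *v v) w"
    by (subst sum.swap) (simp add: hinner_def matrix_vector_mult_def sum_distrib_left sum_distrib_right ac_simps)
  finally show ?thesis by simp
qed

text \<open>Clifford multiplication by a unit vector is skew-Hermitian with square \<open>- 1\<close>.\<close>

lemma hinner_cliff_vec_isometry:
  assumes "clifford_module \<gamma>" "norm u = 1"
  shows "hinner (cliff_vec \<gamma> u *v v) (cliff_vec \<gamma> u *v w) = hinner v w"
proof -
  have "cliff_vec \<gamma> u *v (cliff_vec \<gamma> u *v w) = (- mat 1) *v w"
    by (simp only: matrix_vector_mul_assoc cliff_vec_square[OF assms])
  also have "\<dots> = - (mat 1 *v w)"
    by (simp only: matrix_vector_mult_def vec_eq_iff) (simp add: sum_negf)
  finally have "cliff_vec \<gamma> u *v (cliff_vec \<gamma> u *v w) = - w" by simp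
  then show ?thesis
    by (simp add: hinner_cliff_vec[OF assms(1)]) (simp add: hinner_def sum_negf)
qed

text \<open>All three properties pass from \<open>A\<close> to \<open>v w A\<close> for unit vectors \<open>v\<close> and \<open>w\<close>.  The inverse
  of \<open>v w A\<close> is \<open>A\<inverse> w v\<close>: as \<open>v v = w w = - 1\<close>, the two signs cancel, and conjugation by \<open>v w\<close>
  is a product of two reflections.\<close>

lemma Spin_isometry_preserving_vectors:
  assumes "clifford_module \<gamma>" "A \<in> Spin \<gamma>"
  shows "\<exists>B. A ** B = mat 1 \<and> B ** A = mat 1 \<and>
    (\<forall>v w. hinner (A *v v) (A *v w) = hinner v w) \<and>
    (\<forall>u. \<exists>u'. A ** cliff_vec \<gamma> u ** B = cliff_vec \<gamma> u')"
  using assms(2)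
proof (induction rule: Spin.induct)
  case one
  show ?case by (rule exI[of _ "mat 1"]) auto
next
  case (mult A v w)
  let ?v = "cliff_vec \<gamma> v" and ?w = "cliff_vec \<gamma> w"
  obtain B where B: "A ** B = mat 1" "B ** A = mat 1"
    "\<And>v w. hinner (A *v v) (A *v w) = hinner v w"
    "\<And>u. \<exists>u'. A ** cliff_vec \<gamma> u ** B = cliff_vec \<gamma> u'"
    using mult.IH by blast
  have inv: "?v ** (?w ** (?w ** ?v)) = mat 1" "?w ** (?v ** (?v ** ?w)) = mat 1"
  proof -
    have "P ** (Q ** (Q ** P)) = mat 1" if "P ** P = - mat 1" "Q ** Q = - mat 1"
      for P Q :: "complex^'b^'b"
    proof -
      have "P ** (Q ** (Q ** P)) = P ** ((Q ** Q) ** P)" by (simp add: matrix_mul_assoc)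
      also have "\<dots> = P ** (((-1) *\<^sub>R mat 1) ** P)" by (simp add: that)
      also have "\<dots> = (-1) *\<^sub>R (P ** P)"
        by (simp only: matrix_mult_scaleR_left matrix_mult_scaleR_right matrix_mul_lid)
      finally show ?thesis by (simp add: that)
    qed
    note * = this
    show "?v ** (?w ** (?w ** ?v)) = mat 1" "?w ** (?v ** (?v ** ?w)) = mat 1"
      by (intro * cliff_vec_square[OF assms(1)] mult.hyps)+
  qed
  show ?case
  proof (intro exI[of _ "B ** (?w ** ?v)"] conjI allI)
    have "?v ** ?w ** A ** (B ** (?w ** ?v)) = ?v ** (?w ** ((A ** B) ** (?w ** ?v)))"
      by (simp add: matrix_mul_assoc)
    then show "?v ** ?w ** A ** (B ** (?w ** ?v)) = mat 1" by (simp add: B inv)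
    have "B ** (?w ** ?v) ** (?v ** ?w ** A) = B ** ((?w ** (?v ** (?v ** ?w))) ** A)"
      by (simp add: matrix_mul_assoc)
    then show "B ** (?w ** ?v) ** (?v ** ?w ** A) = mat 1" by (simp add: B inv)
    show "hinner ((?v ** ?w ** A) *v x) ((?v ** ?w ** A) *v y) = hinner x y" for x y
      by (simp only: matrix_vector_mul_assoc[symmetric] B(3)
          hinner_cliff_vec_isometry[OF assms(1) mult.hyps(2)]
          hinner_cliff_vec_isometry[OF assms(1) mult.hyps(3)])
    fix u
    obtain u1 where u1: "A ** cliff_vec \<gamma> u ** B = cliff_vec \<gamma> u1" using B(4) by blast
    have "?v ** ?w ** A ** cliff_vec \<gamma> u ** (B ** (?w ** ?v))
       = ?v ** (?w ** (A ** cliff_vec \<gamma> u ** B) ** ?w) ** ?v"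
      by (simp add: matrix_mul_assoc)
    then show "\<exists>u'. ?v ** ?w ** A ** cliff_vec \<gamma> u ** (B ** (?w ** ?v)) = cliff_vec \<gamma> u'"
      unfolding u1 cliff_vec_reflection[OF assms(1) mult.hyps(2)]
        cliff_vec_reflection[OF assms(1) mult.hyps(3)] by blast
  qed
qed

lemma Spin_covers_rotation:
  assumes "clifford_module \<gamma>" "A \<in> Spin \<gamma>"
  shows "\<exists>R. spin_covers \<gamma> A R"
proof -
  obtain B where B: "A ** B = mat 1" "B ** A = mat 1"
    "\<And>u. \<exists>u'. A ** cliff_vec \<gamma> u ** B = cliff_vec \<gamma> u'"
    using Spin_isometry_preserving_vectors[OF assms] by blast
  have inv: "matrix_inv A = B" by (rule matrix_inv_eqI[OF B(1,2)])
  obtain r where "\<And>j. A ** cliff_vec \<gamma> (axis j 1) ** B = cliff_vec \<gamma> (r j)"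
    using choice[of "\<lambda>j u'. A ** cliff_vec \<gamma> (axis j 1) ** B = cliff_vec \<gamma> u'"] B(3) by blast
  then have "spin_covers \<gamma> A (\<chi> i j. r j $ i)"
    by (simp add: spin_covers_def inv cliff_vec_axis) (simp add: cliff_vec_def)
  then show ?thesis ..
qed

lemma hinner_Spin_inverse:
  assumes "clifford_module \<gamma>" "A \<in> Spin \<gamma>"
  shows "hinner (matrix_inv A *v v) (matrix_inv A *v w) = hinner v w"
proof -
  obtain B where B: "A ** B = mat 1" "B ** A = mat 1"
    "\<And>v w. hinner (A *v v) (A *v w) = hinner v w"
    using Spin_isometry_preserving_vectors[OF assms] by blast
  then have "A ** matrix_inv A = mat 1" by (simp add: matrix_inv_eqI)
  with B(3)[of "matrix_inv A *v v" "matrix_inv A *v w"] show ?thesis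
    by (simp add: matrix_vector_mul_assoc)
qed

section \<open>Local sections of the bundle of spin frames\<close>

lemma chart_homeomorphism:
  assumes "oriented_riemannian_manifold M" "c \<in> charts M"
  shows "homeomorphism (cdom c) (cmap c ` cdom c) (cmap c) (cinv c)"
    and "open (cdom c)" "open (cmap c ` cdom c)"
  using assms by (auto simp: oriented_riemannian_manifold_def oriented_atlas_def)

lemma cinv_cmap:
  assumes "oriented_riemannian_manifold M" "c \<in> charts M" "x \<in> cdom c"
  shows "cinv c (cmap c x) = x"
  using chart_homeomorphism(1)[OF assms(1,2)] assms(3) by (auto simp: homeomorphism_def)

lemma open_cmap_image:
  assumes "oriented_riemannian_manifold M" "c \<in> charts M" "open U"
  shows "open (cmap c ` (U \<inter> cdom c))"
proof -
  have "openin (top_of_set (cdom c)) (U \<inter> cdom c)"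
    using assms(3) by (metis Int_commute openin_open_Int)
  then have "openin (top_of_set (cmap c ` cdom c)) (cmap c ` (U \<inter> cdom c))"
    using chart_homeomorphism(1)[OF assms(1,2)] homeomorphism_imp_open_map by blast
  then show ?thesis
    using chart_homeomorphism(3)[OF assms(1,2)] openin_open_trans by blast
qed

lemma chart_at_is_chart:
  assumes "oriented_riemannian_manifold M"
  shows "is_chart_at M (chart_at M x) x"
proof -
  have "\<exists>c. is_chart_at M c x"
  proof -
    have "(\<Union>c\<in>charts M. cdom c) = UNIV"
      using assms by (simp add: oriented_riemannian_manifold_def oriented_atlas_def)
    then have "x \<in> (\<Union>c\<in>charts M. cdom c)" by simp
    then show ?thesis by (auto simp: is_chart_at_def)
  qed
  then show ?thesis unfolding chart_at_def by (rule someI_ex)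
qed

lemma spin_structureD:
  assumes "spin_structure M"
  shows "clifford_module (gam M)"
    and "continuous_on (UNIV \<times> Spin (gam M)) (\<lambda>(p, A). act M p A)"
    and "\<forall>p. \<forall>A\<in>Spin (gam M). proj M (act M p A) = proj M p"
    and "\<forall>p q. proj M p = proj M q \<longrightarrow> (\<exists>!A. A \<in> Spin (gam M) \<and> q = act M p A)"
    and "\<forall>p. \<forall>A\<in>Spin (gam M). \<forall>R. spin_covers (gam M) A R \<longrightarrow>
        (\<forall>j c. frame M (act M p A) j c = (\<Sum>i\<in>UNIV. R $ i $ j *\<^sub>R frame M p i c))"
proof -
  note S = assms[unfolded spin_structure_def]
  show "clifford_module (gam M)"
    using S by (elim conjE)
  show "continuous_on (UNIV \<times> Spin (gam M)) (\<lambda>(p, A). act M p A)"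
    using S by (elim conjE)
  show "\<forall>p. \<forall>A\<in>Spin (gam M). proj M (act M p A) = proj M p"
    using S by (elim conjE)
  show "\<forall>p q. proj M p = proj M q \<longrightarrow> (\<exists>!A. A \<in> Spin (gam M) \<and> q = act M p A)"
    using S by (elim conjE)
  show "\<forall>p. \<forall>A\<in>Spin (gam M). \<forall>R. spin_covers (gam M) A R \<longrightarrow>
      (\<forall>j c. frame M (act M p A) j c = (\<Sum>i\<in>UNIV. R $ i $ j *\<^sub>R frame M p i c))"
    using S by (elim conjE)
qed

text \<open>The frame field under the moved section is a combination of the old one with constant
  coefficients.\<close>

lemma smooth_section_act:
  assumes "riemannian_spin_manifold M" "smooth_section M U s" "A \<in> Spin (gam M)"
  shows "smooth_section M U (\<lambda>y. act M (s y) A)"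
proof -
  have M: "oriented_riemannian_manifold M" and S: "spin_structure M"
    using assms(1) by (auto simp: riemannian_spin_manifold_def)
  have U: "open U" "continuous_on U s" "\<And>x. x \<in> U \<Longrightarrow> proj M (s x) = x"
    and frame_smooth: "\<And>c i. c \<in> charts M \<Longrightarrow>
      smooth_on (cmap c ` (U \<inter> cdom c)) (\<lambda>y. frame M (s (cinv c y)) i c)"
    using assms(2) by (auto simp: smooth_section_def)
  note act = spin_structureD[OF S]
  obtain R where R: "spin_covers (gam M) A R"
    using Spin_covers_rotation[OF act(1) assms(3)] by blast
  then have rot: "frame M (act M p A) j c = (\<Sum>i\<in>UNIV. R $ i $ j *\<^sub>R frame M p i c)" for p j c
    using act(5) assms(3) by blast
  have "continuous_on (UNIV \<times> Spin (gam M)) (\<lambda>(p, A). act M p A)"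
    by (rule act(2))
  then have "continuous_on U (\<lambda>y. (\<lambda>(p, A). act M p A) (s y, A))"
    by (rule continuous_on_compose2) (use U assms(3) in \<open>auto intro!: continuous_on_Pair\<close>)
  moreover have "proj M (act M (s x) A) = x" if "x \<in> U" for x
    using act(3) assms(3) U(3)[OF that] by simp
  moreover have "smooth_on (cmap c ` (U \<inter> cdom c)) (\<lambda>y. frame M (act M (s (cinv c y)) A) i c)"
    if "c \<in> charts M" for c i
    using frame_smooth[OF that] open_cmap_image[OF M that U(1)] unfolding rot smooth_on_def
    by (intro allI Ck_on_sum Ck_on_scaleR Ck_on_const) auto
  ultimately show ?thesis using U(1) by (auto simp: smooth_section_def)
qed

text \<open>Any local section around the base point differs from \<open>p\<close> at that point by an element of
  the spin group, which then acts on the whole section.  This makes the choice in \<open>section_at\<close>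
  meaningful.\<close>

lemma smooth_section_through:
  assumes "riemannian_spin_manifold M"
  shows "\<exists>s U. proj M p \<in> U \<and> smooth_section M U s \<and> s (proj M p) = p"
proof -
  have S: "spin_structure M" using assms by (simp add: riemannian_spin_manifold_def)
  obtain U s where U: "proj M p \<in> U" "smooth_section M U s"
    using S unfolding spin_structure_def by meson
  then have "proj M (s (proj M p)) = proj M p" by (simp add: smooth_section_def)
  moreover note spin_structureD(4)[OF S]
  ultimately obtain A where "A \<in> Spin (gam M)" "p = act M (s (proj M p)) A" by metis
  with U smooth_section_act[OF assms U(2)] show ?thesis by metis
qed

lemma proj_surjective:
  assumes "riemannian_spin_manifold M"
  shows "\<exists>p. proj M p = x"
proof -
  have "\<exists>U s. x \<in> U \<and> smooth_section M U s"
    using assms unfolding riemannian_spin_manifold_def spin_structure_def by meson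
  then show ?thesis by (auto simp: smooth_section_def)
qed

lemma section_at_through:
  assumes "riemannian_spin_manifold M"
  obtains U where "proj M p \<in> U" "smooth_section M U (section_at M p)"
    "section_at M p (proj M p) = p"
  using someI_ex[OF smooth_section_through[OF assms, of p]] unfolding section_at_def by blast

section \<open>The product rule for the Dirac operator\<close>

lemma matrix_vector_scaleR: "A *v (r *\<^sub>R v) = r *\<^sub>R (A *v v)"
  for A :: "complex ^ 's ^ 's::finite"
  by (simp add: matrix_vector_mult_def vec_eq_iff scaleR_sum_right)

lemma cliff_vec_apply: "cliff_vec \<gamma> v *v w = (\<Sum>i\<in>UNIV. v $ i *\<^sub>R (\<gamma> i *v w))"
  by (simp add: cliff_vec_def matrix_vector_mult_def vec_eq_iff sum_distrib_right scaleR_sum_right)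
    (intro allI, rule sum.swap)

text \<open>The components of \<open>e\<^sub>i\<close> in the orthonormal frame \<open>e\<close> are those of a basis vector.\<close>

lemma cliff_frame:
  assumes "spin_structure M"
  shows "cliff M p (frame M p i) w = gam M i *v w"
proof -
  have "ginner M (proj M p) (frame M p i) (frame M p k) = (if i = k then 1 else 0)" for k
    using assms by (simp add: spin_structure_def oriented_orthonormal_frame_def)
  then have "cliff M p (frame M p i) w = (\<Sum>k\<in>UNIV. if k = i then gam M k *v w else 0)"
    unfolding cliff_def cliff_vec_apply by (intro sum.cong) auto
  then show ?thesis by simp
qed

lemma smooth_fun_uminus:
  assumes "oriented_riemannian_manifold M" "smooth_fun M f"
  shows "smooth_fun M (\<lambda>x. - f x)"
proof -
  have "Ck_on k (cmap c ` cdom c) ((\<lambda>x. - f x) \<circ> cinv c)" if c: "c \<in> charts M" for k c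
  proof -
    have "Ck_on k (cmap c ` cdom c) (\<lambda>x. (- 1) *\<^sub>R (f \<circ> cinv c) x)"
      using assms c by (intro Ck_on_scaleR Ck_on_const chart_homeomorphism(3)[OF assms(1) c])
        (simp only: smooth_fun_def smooth_on_def)
    then show ?thesis by (simp add: comp_def)
  qed
  then show ?thesis by (auto simp: smooth_fun_def smooth_on_def)
qed

lemma smooth_fun_differentiable:
  assumes "smooth_fun M f" "is_chart_at M c x"
  shows "(f \<circ> cinv c) differentiable (at (cmap c x))"
proof -
  have "Ck_on (Suc 0) (cmap c ` cdom c) (f \<circ> cinv c)"
    using assms unfolding smooth_fun_def smooth_on_def is_chart_at_def by blast
  then show ?thesis using assms(2) by (auto simp: is_chart_at_def)
qed

lemma linear_axis_expansion:
  fixes D :: "real ^ 'n::finite \<Rightarrow> real"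
  assumes "linear D"
  shows "D w = (\<chi> i. D (axis i 1)) \<bullet> w"
proof -
  have "D w = D (\<Sum>i\<in>UNIV. w $ i *\<^sub>R axis i 1)"
    using basis_expansion[of w] by (simp add: scalar_mult_eq_scaleR)
  also have "\<dots> = (\<Sum>i\<in>UNIV. w $ i * D (axis i 1))"
    using assms by (simp add: linear_sum linear_scale)
  finally show ?thesis by (simp add: inner_vec_def mult.commute)
qed

text \<open>The matrix \<open>G\<close> of the metric is symmetric and, being positive definite, invertible; it
  cancels the inverse in the definition of the gradient, which leaves the differential of \<open>f\<close>.\<close>

lemma ginner_grad:
  assumes "oriented_riemannian_manifold M" "smooth_fun M f"
  shows "ginner M x (grad M f x) v = directional (chart_at M x) x (v (chart_at M x)) f"
proof -
  define c where "c = chart_at M x"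
  define G where "G = gmat M c x"
  define d where "d = (\<chi> i. directional c x (axis i 1) f)"
  have c: "is_chart_at M c x"
    using chart_at_is_chart[OF assms(1)] by (simp add: c_def)
  have sym: "transpose G = G" and pos: "\<And>v. v \<noteq> 0 \<Longrightarrow> v \<bullet> (G *v v) > 0"
    using assms(1) c
    by (auto simp: oriented_riemannian_manifold_def riemannian_metric_def is_chart_at_def G_def)
  have "\<exists>B. B ** G = mat 1"
    unfolding matrix_left_invertible_ker using pos by force
  then have "\<exists>B. G ** B = mat 1 \<and> B ** G = mat 1"
    using matrix_left_right_inverse by blast
  then have inv: "G ** matrix_inv G = mat 1"
    unfolding matrix_inv_def by (rule someI2_ex) blast
  have "ginner M x (grad M f x) v = (matrix_inv G *v d) \<bullet> (G *v v c)"
    using c by (simp add: ginner_def grad_def Let_def c_def[symmetric] G_def d_def)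
  also have "\<dots> = (G *v (matrix_inv G *v d)) \<bullet> v c"
    using dot_lmul_matrix[of "matrix_inv G *v d" G "v c"] sym
    by (metis transpose_matrix_vector)
  also have "\<dots> = d \<bullet> v c" by (simp add: matrix_vector_mul_assoc inv)
  also have "\<dots> = directional c x (v c) f"
    unfolding d_def directional_def
    using linear_axis_expansion[of "frechet_derivative (f \<circ> cinv c) (at (cmap c x))" "v c"]
      linear_frechet_derivative[OF smooth_fun_differentiable[OF assms(2) c]] by simp
  finally show ?thesis by (simp add: c_def)
qed

text \<open>Expansion \<open>\<nabla>f = \<Sum>\<^sub>i e\<^sub>i(f) e\<^sub>i\<close> of the gradient in an orthonormal frame.\<close>

lemma cliff_grad:
  assumes "oriented_riemannian_manifold M" "smooth_fun M f"
  shows "cliff M p (grad M f (proj M p)) w =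
    (let c = chart_at M (proj M p) in
     \<Sum>i\<in>UNIV. directional c (proj M p) (frame M p i c) f *\<^sub>R (gam M i *v w))"
  by (simp add: cliff_def cliff_vec_apply ginner_grad[OF assms] Let_def)

text \<open>The formula is restricted to the domain of \<open>s\<close> because only there \<open>s\<close> is a section of
  the projection, through which \<open>f\<close> enters.\<close>

lemma U_weight_in_section:
  assumes "oriented_riemannian_manifold M" "c \<in> charts M" "smooth_section M U s"
    and "y \<in> cmap c ` (U \<inter> cdom c)"
  shows "(U_weight M f \<psi> \<circ> s \<circ> cinv c) y =
    exp ((f \<circ> cinv c) y / 2) *\<^sub>R (\<psi> \<circ> s \<circ> cinv c) y"
  using assms cinv_cmap[OF assms(1,2)] by (auto simp: U_weight_def smooth_section_def)

lemma spinor_U_weight: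
  assumes "spin_structure M" "spinor M \<psi>"
  shows "spinor M (U_weight M f \<psi>)"
  using assms by (auto simp: spinor_def U_weight_def spin_structure_def matrix_vector_scaleR)

lemma Ck_spinor_U_weight:
  assumes "riemannian_spin_manifold M" "smooth_fun M f" "Ck_spinor k M \<psi>"
  shows "Ck_spinor k M (U_weight M f \<psi>)"
  unfolding Ck_spinor_def
proof (intro conjI allI impI ballI)
  have M: "oriented_riemannian_manifold M" and S: "spin_structure M"
    using assms(1) by (auto simp: riemannian_spin_manifold_def)
  show "spinor M (U_weight M f \<psi>)"
    using S assms(3) by (simp add: spinor_U_weight Ck_spinor_def)
  fix U s c assume s: "smooth_section M U s" and c: "c \<in> charts M"
  then have opn: "open (cmap c ` (U \<inter> cdom c))"
    using open_cmap_image[OF M c] by (simp add: smooth_section_def)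
  have "Ck_on k (cmap c ` cdom c) (f \<circ> cinv c)"
    using assms(2) c by (auto simp: smooth_fun_def smooth_on_def)
  then have f: "Ck_on k (cmap c ` (U \<inter> cdom c)) (f \<circ> cinv c)"
    by (rule Ck_on_subset) auto
  have "Ck_on k (cmap c ` (U \<inter> cdom c)) (\<psi> \<circ> s \<circ> cinv c)"
    using assms(3) s c by (simp add: Ck_spinor_def)
  then have "Ck_on k (cmap c ` (U \<inter> cdom c))
      (\<lambda>y. exp ((f \<circ> cinv c) y / 2) *\<^sub>R (\<psi> \<circ> s \<circ> cinv c) y)"
    by (intro Ck_on_scaleR Ck_on_exp_half opn f)
  then show "Ck_on k (cmap c ` (U \<inter> cdom c)) (U_weight M f \<psi> \<circ> s \<circ> cinv c)"
    by (rule Ck_on_cong[OF opn, rotated]) (simp only: U_weight_in_section[OF M c s])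
qed

text \<open>The connection term of \<open>local_spin_connection\<close> is linear in the value of the spinor; only
  its derivative term contributes to the Leibniz rule.\<close>

lemma nabla_U_weight:
  assumes "riemannian_spin_manifold M" "smooth_fun M f" "Ck_spinor 1 M \<psi>"
  defines "c \<equiv> \<lambda>p. chart_at M (proj M p)"
  shows "nabla M (U_weight M f \<psi>) p v =
    exp (f (proj M p) / 2) *\<^sub>R
      (nabla M \<psi> p v + (1/2) *\<^sub>R directional (c p) (proj M p) (v (c p)) f *\<^sub>R \<psi> p)"
proof -
  have M: "oriented_riemannian_manifold M"
    using assms(1) by (auto simp: riemannian_spin_manifold_def)
  define x where "x = proj M p"
  define s where "s = section_at M p"
  define d where "d = c p"
  \<comment> \<open>Both sides are evaluated in the same section and the same chart, so only the spinor varies.\<close>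
  obtain U where U: "x \<in> U" "smooth_section M U s" and sx: "s x = p"
    using section_at_through[OF assms(1), of p] unfolding x_def s_def by blast
  have d: "is_chart_at M d x" "chart_at M x = d"
    using chart_at_is_chart[OF M] by (simp_all add: d_def c_def x_def)
  then have dM: "d \<in> charts M" and xd: "x \<in> cdom d" by (auto simp: is_chart_at_def)
  let ?S = "cmap d ` (U \<inter> cdom d)" and ?y = "cmap d x"
  let ?a = "\<lambda>y. exp ((f \<circ> cinv d) y / 2)" and ?h = "\<psi> \<circ> s \<circ> cinv d"
  have opn: "open ?S" using open_cmap_image[OF M dM] U(2) by (simp add: smooth_section_def)
  have y: "?y \<in> ?S" using U(1) xd by auto
  have inv: "cinv d ?y = x" by (rule cinv_cmap[OF M dM xd])
  have h: "?h differentiable (at ?y)"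
    using assms(3) U(2) dM y by (auto simp: Ck_spinor_def)
  note f = smooth_fun_differentiable[OF assms(2) d(1)]
  have a: "?a differentiable (at ?y)" by (rule frechet_derivative_exp_half[OF f])
  have "frechet_derivative (U_weight M f \<psi> \<circ> s \<circ> cinv d) (at ?y)
      = frechet_derivative (\<lambda>y. ?a y *\<^sub>R ?h y) (at ?y)"
    by (rule frechet_derivative_cong_on_open(2)[OF opn y])
      (simp_all only: U_weight_in_section[OF M dM U(2)] frechet_derivative_scaleR_fun(1)[OF a h])
  then have "directional d x (v d) (U_weight M f \<psi> \<circ> s) =
      ?a ?y *\<^sub>R directional d x (v d) (\<psi> \<circ> s)
      + (?a ?y *\<^sub>R ((1/2) *\<^sub>R directional d x (v d) f)) *\<^sub>R ?h ?y"
    unfolding directional_def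
    by (simp only: frechet_derivative_scaleR_fun(2)[OF a h] frechet_derivative_exp_half(2)[OF f] o_assoc)
  then have deriv: "directional d x (v d) (U_weight M f \<psi> \<circ> s) =
      exp (f x / 2) *\<^sub>R (directional d x (v d) (\<psi> \<circ> s)
        + (1/2) *\<^sub>R directional d x (v d) f *\<^sub>R \<psi> p)"
    by (simp add: inv sx scaleR_add_right)
  have val: "U_weight M f \<psi> (s x) = exp (f x / 2) *\<^sub>R \<psi> (s x)"
    unfolding sx by (simp add: U_weight_def x_def)
  have "local_spin_connection M s (U_weight M f \<psi>) x v =
    exp (f x / 2) *\<^sub>R
      (local_spin_connection M s \<psi> x v + (1/2) *\<^sub>R directional d x (v d) f *\<^sub>R \<psi> p)"
    unfolding local_spin_connection_def Let_def d(2) deriv val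
    by (simp only: matrix_vector_scaleR scaleR_add_right scaleR_sum_right scaleR_scaleR ac_simps)
  then show ?thesis by (simp add: nabla_def x_def s_def d_def)
qed

text \<open>Summing the Leibniz rule over the frame gives \<open>1/2 \<Sum>\<^sub>i e\<^sub>i(f) e\<^sub>i \<cdot> \<psi> = 1/2 \<nabla>f \<cdot> \<psi>\<close>, the term that
  the weighted operator removes.\<close>

lemma weighted_dirac_U_weight:
  assumes "riemannian_spin_manifold M" "smooth_fun M f" "Ck_spinor 1 M \<psi>"
  shows "weighted_dirac M f (U_weight M f \<psi>) = U_weight M f (dirac M \<psi>)"
proof
  fix p
  have M: "oriented_riemannian_manifold M" and S: "spin_structure M"
    using assms(1) by (auto simp: riemannian_spin_manifold_def)
  let ?x = "proj M p" and ?c = "chart_at M (proj M p)"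
  have "dirac M (U_weight M f \<psi>) p =
      exp (f ?x / 2) *\<^sub>R (dirac M \<psi> p
        + (1/2) *\<^sub>R (\<Sum>i\<in>UNIV. directional ?c ?x (frame M p i ?c) f *\<^sub>R (gam M i *v \<psi> p)))"
    unfolding dirac_def cliff_frame[OF S] nabla_U_weight[OF assms]
    by (simp add: matrix_vector_scaleR matrix_vector_right_distrib scaleR_add_right
        scaleR_sum_right sum.distrib)
  then show "weighted_dirac M f (U_weight M f \<psi>) p = U_weight M f (dirac M \<psi>) p"
    by (simp add: weighted_dirac_def cliff_grad[OF M assms(2)] Let_def U_weight_def
        matrix_vector_scaleR scaleR_add_right scaleR_sum_right mult.commute)
qed

lemma U_weight_uminus [simp]:
  "U_weight M f (U_weight M (\<lambda>x. - f x) \<psi>) = \<psi>"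
  "U_weight M (\<lambda>x. - f x) (U_weight M f \<psi>) = \<psi>"
  by (auto simp: U_weight_def fun_eq_iff simp flip: exp_add)

lemma U_weight_dirac_U_weight:
  assumes "riemannian_spin_manifold M" "smooth_fun M f" "Ck_spinor 1 M \<psi>"
  shows "U_weight M f (dirac M (U_weight M (\<lambda>x. - f x) \<psi>)) = weighted_dirac M f \<psi>"
proof -
  have "smooth_fun M (\<lambda>x. - f x)"
    using assms(1,2) by (simp add: riemannian_spin_manifold_def smooth_fun_uminus)
  then have "Ck_spinor 1 M (U_weight M (\<lambda>x. - f x) \<psi>)"
    using assms(1,3) Ck_spinor_U_weight by blast
  from weighted_dirac_U_weight[OF assms(1,2) this] show ?thesis by simp
qed

section \<open>Transport of operators along a unitary map\<close>

text \<open>The record of a Hilbert space carries no laws.  This one ensures that norms of differences,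
  in which closures and resolvents are expressed, are taken of elements of the carrier, where a
  unitary map preserves them.\<close>

definition hclosed :: "'h hilbert \<Rightarrow> bool" where
  "hclosed H \<longleftrightarrow> (\<forall>x\<in>hcarrier H. \<forall>y\<in>hcarrier H. hadd H x y \<in> hcarrier H) \<and>
     (\<forall>a. \<forall>x\<in>hcarrier H. hscale H a x \<in> hcarrier H)"

lemma hdiff_closed:
  "hclosed H \<Longrightarrow> x \<in> hcarrier H \<Longrightarrow> y \<in> hcarrier H \<Longrightarrow> hdiff H x y \<in> hcarrier H"
  by (simp add: hclosed_def hdiff_def)

lemma unitary_hdiff:
  assumes "unitary H K U" "hclosed H" "x \<in> hcarrier H" "y \<in> hcarrier H"
  shows "U (hdiff H x y) = hdiff K (U x) (U y)"
  using assms by (simp add: unitary_def hclosed_def hdiff_def)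

lemma unitary_hnorm:
  assumes "unitary H K U" "x \<in> hcarrier H"
  shows "hnorm K (U x) = hnorm H x"
  using assms by (simp add: unitary_def hnorm_def)

lemma unitary_in_carrier:
  "unitary H K U \<Longrightarrow> x \<in> hcarrier H \<Longrightarrow> U x \<in> hcarrier K"
  by (auto simp: unitary_def bij_betw_def)

lemma unitary_inj:
  "unitary H K U \<Longrightarrow> x \<in> hcarrier H \<Longrightarrow> y \<in> hcarrier H \<Longrightarrow> U x = U y \<longleftrightarrow> x = y"
  by (auto simp: unitary_def bij_betw_def inj_on_def)

lemma unitary_preimage:
  assumes "unitary H K U" "y \<in> hcarrier K"
  obtains x where "x \<in> hcarrier H" "y = U x"
proof -
  have "y \<in> U ` hcarrier H" using assms by (simp add: unitary_def bij_betw_def)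
  with that show thesis by blast
qed

lemma closure_op_iff:
  "(x, y) \<in> closure_op H A \<longleftrightarrow> x \<in> hcarrier H \<and> y \<in> hcarrier H \<and>
    (\<exists>X Y. (\<forall>i. (X i, Y i) \<in> A) \<and>
      (\<lambda>i. hnorm H (hdiff H (X i) x)) \<longlonglongrightarrow> 0 \<and> (\<lambda>i. hnorm H (hdiff H (Y i) y)) \<longlonglongrightarrow> 0)"
  by (simp add: closure_op_def)

text \<open>Distances to the limit are preserved by \<open>U\<close>, so graph-convergent sequences correspond to
  each other.\<close>

lemma closure_op_unitary_image:
  assumes U: "unitary H K U" and cl: "hclosed H" and A: "A \<subseteq> hcarrier H \<times> hcarrier H"
  shows "closure_op K (map_prod U U ` A) = map_prod U U ` closure_op H A"
proof -
  have lim: "(\<lambda>i. hnorm K (hdiff K (U (X i)) (U x))) = (\<lambda>i. hnorm H (hdiff H (X i) x))"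
    if "\<And>i::nat. X i \<in> hcarrier H" "x \<in> hcarrier H" for X x
    using that
    by (simp add: unitary_hdiff[OF U cl, symmetric] unitary_hnorm[OF U] hdiff_closed[OF cl])
  show ?thesis
  proof (intro set_eqI iffI)
    fix z assume z: "z \<in> closure_op K (map_prod U U ` A)"
    obtain x' y' where z': "z = (x', y')" by (cases z)
    from z obtain X' Y' where xy': "x' \<in> hcarrier K" "y' \<in> hcarrier K"
      and in': "\<And>i::nat. (X' i, Y' i) \<in> map_prod U U ` A"
      and lim': "(\<lambda>i. hnorm K (hdiff K (X' i) x')) \<longlonglongrightarrow> 0" "(\<lambda>i. hnorm K (hdiff K (Y' i) y')) \<longlonglongrightarrow> 0"
      unfolding z' closure_op_iff by blast
    obtain x where x: "x \<in> hcarrier H" "x' = U x" by (rule unitary_preimage[OF U xy'(1)])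
    obtain y where y: "y \<in> hcarrier H" "y' = U y" by (rule unitary_preimage[OF U xy'(2)])
    have "\<forall>i. \<exists>w. w \<in> A \<and> (X' i, Y' i) = map_prod U U w"
      by (intro allI in'[unfolded image_iff Bex_def])
    from choice[OF this] obtain W where W: "\<And>i. W i \<in> A" "\<And>i. (X' i, Y' i) = map_prod U U (W i)"
      by blast
    define X Y where "X = (\<lambda>i. fst (W i))" and "Y = (\<lambda>i. snd (W i))"
    have XY: "(X i, Y i) \<in> A" "X' i = U (X i)" "Y' i = U (Y i)" for i
      using W(1)[of i] W(2)[of i] by (cases "W i"; simp add: X_def Y_def)+
    have "X i \<in> hcarrier H" "Y i \<in> hcarrier H" for i using XY(1)[of i] A by auto
    then have "(\<lambda>i. hnorm H (hdiff H (X i) x)) \<longlonglongrightarrow> 0" "(\<lambda>i. hnorm H (hdiff H (Y i) y)) \<longlonglongrightarrow> 0"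
      using lim' lim x y by (simp_all add: XY(2,3))
    then have "(x, y) \<in> closure_op H A"
      using XY(1) x(1) y(1) unfolding closure_op_iff by blast
    then show "z \<in> map_prod U U ` closure_op H A" unfolding z' x(2) y(2) by (rule image_eqI[rotated]) simp
  next
    fix z assume "z \<in> map_prod U U ` closure_op H A"
    then obtain x y where z: "z = (U x, U y)" "(x, y) \<in> closure_op H A" by auto
    then obtain X Y where xy: "x \<in> hcarrier H" "y \<in> hcarrier H"
      and XY: "\<And>i::nat. (X i, Y i) \<in> A"
      and lim': "(\<lambda>i. hnorm H (hdiff H (X i) x)) \<longlonglongrightarrow> 0" "(\<lambda>i. hnorm H (hdiff H (Y i) y)) \<longlonglongrightarrow> 0"
      unfolding closure_op_iff by blast
    have "X i \<in> hcarrier H" "Y i \<in> hcarrier H" for i using XY[of i] A by auto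
    then have "(\<lambda>i. hnorm K (hdiff K (U (X i)) (U x))) \<longlonglongrightarrow> 0"
      "(\<lambda>i. hnorm K (hdiff K (U (Y i)) (U y))) \<longlonglongrightarrow> 0"
      using lim' lim xy by simp_all
    moreover have "(U (X i), U (Y i)) \<in> map_prod U U ` A" for i
      by (rule image_eqI[OF _ XY[of i]]) simp
    ultimately show "z \<in> closure_op K (map_prod U U ` A)"
      unfolding closure_op_iff z(1) using unitary_in_carrier[OF U xy(1)] unitary_in_carrier[OF U xy(2)]
      by (intro conjI exI[of _ "\<lambda>i. U (X i)"] exI[of _ "\<lambda>i. U (Y i)"] allI)
  qed
qed

lemma unitarily_equivalent_image:
  assumes U: "unitary H K U" and A: "A \<subseteq> hcarrier H \<times> hcarrier H"
  shows "unitarily_equivalent H A K (map_prod U U ` A)"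
  unfolding unitarily_equivalent_def
proof (intro exI[of _ U] conjI ballI)
  let ?B = "map_prod U U ` A"
  show "unitary H K U" by (rule U)
  show "U ` Domain A = Domain ?B" by (simp add: Domain_fst image_image)
  fix x' assume "x' \<in> Domain ?B"
  then obtain x where x: "x \<in> hcarrier H" "x' = U x" using A by auto
  then have inv: "inv_into (hcarrier H) U x' = x"
    using U by (simp add: unitary_def bij_betw_def)
  have mem: "(U x, y) \<in> ?B \<longleftrightarrow> y \<in> U ` (A `` {x})" for y
  proof
    assume "(U x, y) \<in> ?B"
    then obtain u w where uw: "(u, w) \<in> A" "U x = U u" "y = U w" by auto
    then have "u = x" using A x(1) unitary_inj[OF U, of x u] by auto
    with uw show "y \<in> U ` (A `` {x})" by blast
  next
    assume "y \<in> U ` (A `` {x})"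
    then obtain w where "(x, w) \<in> A" "y = U w" by blast
    then show "(U x, y) \<in> ?B" by (intro image_eqI[of _ _ "(x, w)"]) auto
  qed
  show "U ` (A `` {inv_into (hcarrier H) U x'}) = ?B `` {x'}"
    unfolding inv unfolding x(2) by (intro set_eqI) (simp only: mem Image_singleton_iff)
qed

lemma Ex1_image:
  assumes "inj_on g S" "\<And>x. P x \<Longrightarrow> x \<in> S"
  shows "(\<exists>!y. \<exists>x. y = g x \<and> P x) \<longleftrightarrow> (\<exists>!x. P x)"
proof
  assume "\<exists>!y. \<exists>x. y = g x \<and> P x"
  then obtain x where x: "P x" and u: "\<And>x'. P x' \<Longrightarrow> g x' = g x" by auto
  show "\<exists>!x. P x"
    using x u assms by (intro ex1I[of _ x]) (auto dest: inj_onD)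
qed auto

text \<open>On the graph, \<open>B - l\<close> at \<open>U x\<close> is the image of \<open>A - l\<close> at \<open>x\<close>; unique solvability and the
  bound on the inverse transfer along the bijection \<open>U\<close>.\<close>

lemma isospectral_image:
  assumes U: "unitary H K U" and cl: "hclosed H" and A: "A \<subseteq> hcarrier H \<times> hcarrier H"
  shows "isospectral H A K (map_prod U U ` A)"
proof -
  let ?B = "map_prod U U ` A"
  have eq: "hdiff K (U z) (hscale K l (U x)) = U (hdiff H z (hscale H l x))"
    and car: "hdiff H z (hscale H l x) \<in> hcarrier H"
    if "(x, z) \<in> A" for x z l
    using that A U cl unitary_hdiff[OF U cl] hdiff_closed[OF cl]
    by (auto simp: unitary_def hclosed_def)
  have "l \<in> resolvent_set K ?B \<longleftrightarrow> l \<in> resolvent_set H A" for l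
  proof -
    let ?P = "\<lambda>y x. \<exists>z. (x, z) \<in> A \<and> hdiff H z (hscale H l x) = y"
    let ?Q = "\<lambda>y x. \<exists>z. (x, z) \<in> ?B \<and> hdiff K z (hscale K l x) = y"
    have PQ: "?Q (U y) x' \<longleftrightarrow> (\<exists>x. x' = U x \<and> ?P y x)" if "y \<in> hcarrier H" for y x'
    proof
      assume "?Q (U y) x'"
      then obtain x z where xz: "(x, z) \<in> A" "x' = U x" "hdiff K (U z) (hscale K l (U x)) = U y"
        by auto
      then have "hdiff H z (hscale H l x) = y"
        using eq[OF xz(1)] unitary_inj[OF U car[OF xz(1)] that] by simp
      with xz show "\<exists>x. x' = U x \<and> ?P y x" by blast
    next
      assume "\<exists>x. x' = U x \<and> ?P y x"
      then obtain x z where xz: "(x, z) \<in> A" "x' = U x" "hdiff H z (hscale H l x) = y" by blast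
      then have "(x', U z) \<in> ?B" by (intro image_eqI[of _ _ "(x, z)"]) auto
      with eq[OF xz(1)] xz show "?Q (U y) x'" by blast
    qed
    have ex1: "(\<exists>!x. ?Q (U y) x) \<longleftrightarrow> (\<exists>!x. ?P y x)" if "y \<in> hcarrier H" for y
      unfolding PQ[OF that]
      by (rule Ex1_image[of U "hcarrier H"]) (use A U in \<open>auto simp: unitary_def bij_betw_def\<close>)
    have carK: "hcarrier K = U ` hcarrier H" using U by (simp add: unitary_def bij_betw_def)
    have bound: "(\<forall>(x, z)\<in>?B. hnorm K x \<le> C * hnorm K (hdiff K z (hscale K l x))) \<longleftrightarrow>
      (\<forall>(x, z)\<in>A. hnorm H x \<le> C * hnorm H (hdiff H z (hscale H l x)))" for C
    proof -
      have "hnorm K (U x) = hnorm H x" if "(x, z) \<in> A" for x z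
        using that A unitary_hnorm[OF U] by auto
      moreover have "hnorm K (hdiff K (U z) (hscale K l (U x))) = hnorm H (hdiff H z (hscale H l x))"
        if "(x, z) \<in> A" for x z
        using eq[OF that] car[OF that] unitary_hnorm[OF U] by simp
      ultimately show ?thesis by fastforce
    qed
    have "(\<forall>y\<in>hcarrier K. \<exists>!x. ?Q y x) \<longleftrightarrow> (\<forall>y\<in>hcarrier H. \<exists>!x. ?P y x)"
      unfolding carK by (simp only: ball_simps ex1 cong: ball_cong)
    then show ?thesis by (simp only: resolvent_set_def mem_Collect_eq bound)
  qed
  then show ?thesis by (auto simp: isospectral_def spectrum_def)
qed

section \<open>Measurable spinors and their pointwise product\<close>

text \<open>Smoothness is given chart by chart, and the chart domains form an open cover.\<close>

lemma continuous_on_smooth_fun: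
  assumes "oriented_riemannian_manifold M" "smooth_fun M f"
  shows "continuous_on UNIV f"
proof -
  have "continuous_on (cdom c) f" if c: "c \<in> charts M" for c
  proof -
    have "Ck_on 0 (cmap c ` cdom c) (f \<circ> cinv c)"
      using assms(2) c unfolding smooth_fun_def smooth_on_def by blast
    then have "continuous_on (cmap c ` cdom c) (f \<circ> cinv c)" by simp
    moreover have "continuous_on (cdom c) (cmap c)"
      using chart_homeomorphism(1)[OF assms(1) c] by (simp add: homeomorphism_def)
    ultimately have "continuous_on (cdom c) (\<lambda>x. (f \<circ> cinv c) (cmap c x))"
      by (rule continuous_on_compose2) simp
    then show ?thesis
      by (rule continuous_on_eq) (simp add: cinv_cmap[OF assms(1) c])
  qed
  then have "continuous_on (\<Union>c\<in>charts M. cdom c) f"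
    by (intro continuous_on_open_UN chart_homeomorphism(2)[OF assms(1)])
  moreover have "(\<Union>c\<in>charts M. cdom c) = UNIV"
    using assms(1) by (simp add: oriented_riemannian_manifold_def oriented_atlas_def)
  ultimately show ?thesis by simp
qed

lemma borel_measurable_smooth_fun:
  assumes "oriented_riemannian_manifold M" "smooth_fun M f"
  shows "f \<in> borel_measurable borel"
  using continuous_on_smooth_fun[OF assms] by (rule borel_measurable_continuous_onI)

lemma measurable_spinor_U_weight:
  assumes "riemannian_spin_manifold M" "smooth_fun M f" "measurable_spinor M \<psi>"
  shows "measurable_spinor M (U_weight M f \<psi>)"
  unfolding measurable_spinor_def
proof (intro conjI allI impI)
  have M: "oriented_riemannian_manifold M" and S: "spin_structure M"
    using assms(1) by (auto simp: riemannian_spin_manifold_def)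
  show "spinor M (U_weight M f \<psi>)"
    using S assms(3) by (simp add: spinor_U_weight measurable_spinor_def)
  fix U s assume s: "smooth_section M U s"
  have [measurable]: "f \<in> borel_measurable (restrict_space borel U)"
    using borel_measurable_smooth_fun[OF M assms(2)] by (rule measurable_restrict_space1)
  have [measurable]: "\<psi> \<circ> s \<in> borel_measurable (restrict_space borel U)"
    using assms(3) s by (simp add: measurable_spinor_def)
  have meas: "(\<lambda>x. exp (f x / 2) *\<^sub>R (\<psi> \<circ> s) x) \<in> borel_measurable (restrict_space borel U)"
    by measurable
  have eq: "(U_weight M f \<psi> \<circ> s) x = exp (f x / 2) *\<^sub>R (\<psi> \<circ> s) x"
    if "x \<in> space (restrict_space borel U)" for x
    using that s by (simp add: space_restrict_space smooth_section_def U_weight_def)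
  show "U_weight M f \<psi> \<circ> s \<in> borel_measurable (restrict_space borel U)"
    using meas by (subst measurable_cong[OF eq])
qed

text \<open>Two spin frames over the same point differ by an element of the spin group, which acts by an
  isometry of the spinor module; so the frame chosen in \<open>pairing\<close> can be replaced by any other,
  in particular by the value of a local section.\<close>

lemma pairing_at:
  assumes "riemannian_spin_manifold M" "spinor M \<psi>" "spinor M \<phi>" "proj M p = x"
  shows "pairing M \<psi> \<phi> x = hinner (\<psi> p) (\<phi> p)"
proof -
  have S: "spin_structure M" using assms(1) by (simp add: riemannian_spin_manifold_def)
  define q where "q = (SOME q. proj M q = x)"
  have "proj M q = x"
    using assms(4) unfolding q_def by (rule someI)
  then obtain A where A: "A \<in> Spin (gam M)" "q = act M p A"
    using spin_structureD(4)[OF S] assms(4) by metis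
  have "\<psi> q = matrix_inv A *v \<psi> p" "\<phi> q = matrix_inv A *v \<phi> p"
    using assms(2,3) A by (simp_all add: spinor_def)
  then show ?thesis
    using hinner_Spin_inverse[OF spin_structureD(1)[OF S] A(1)]
    by (simp add: pairing_def q_def[symmetric])
qed

lemma borel_measurable_hinner:
  fixes v w :: "'a \<Rightarrow> complex ^ 's::finite"
  assumes "v \<in> borel_measurable N" "w \<in> borel_measurable N"
  shows "(\<lambda>x. hinner (v x) (w x)) \<in> borel_measurable N"
proof -
  have "continuous_on UNIV (\<lambda>(v :: complex ^ 's, w). hinner v w)"
    by (auto simp: hinner_def split_beta intro!: continuous_intros)
  from borel_measurable_continuous_Pair[OF assms this[unfolded split_beta, simplified]]
  show ?thesis by simp
qed

text \<open>Over the domain of a local section the pairing is a continuous function of two measurable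
  ones.  Second countability reduces the cover by such domains to a countable one, over which
  measurability can be tested piecewise.\<close>

lemma borel_measurable_pairing:
  assumes "riemannian_spin_manifold M" "measurable_spinor M \<psi>" "measurable_spinor M \<phi>"
  shows "pairing M \<psi> \<phi> \<in> borel_measurable borel"
proof -
  define F where "F = {U. \<exists>s. smooth_section M U s}"
  have "open U" if "U \<in> F" for U using that by (auto simp: F_def smooth_section_def)
  then obtain F' where F': "F' \<subseteq> F" "countable F'" "\<Union>F' = \<Union>F" using Lindelof by metis
  have "x \<in> \<Union>F" for x
  proof -
    obtain p where "proj M p = x" using proj_surjective[OF assms(1)] by blast
    then show ?thesis
      using smooth_section_through[OF assms(1), of p] unfolding F_def by blast
  qed
  then have cover: "\<Union>F' = UNIV" using F'(3) by auto
  show ?thesis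
  proof (rule measurable_piecewise_restrict[OF F'(2)])
    show "space borel \<subseteq> \<Union>F'" using cover by simp
    fix U assume "U \<in> F'"
    then obtain s where s: "smooth_section M U s" using F'(1) by (auto simp: F_def)
    then have "open U" by (simp add: smooth_section_def)
    then show "U \<inter> space borel \<in> sets borel" by simp
    have meas: "(\<lambda>x. hinner ((\<psi> \<circ> s) x) ((\<phi> \<circ> s) x)) \<in> borel_measurable (restrict_space borel U)"
    proof -
      have "\<psi> \<circ> s \<in> borel_measurable (restrict_space borel U)"
        "\<phi> \<circ> s \<in> borel_measurable (restrict_space borel U)"
        using assms(2,3) s by (simp_all add: measurable_spinor_def)
      from borel_measurable_hinner[OF this] show ?thesis .
    qed
    have eq: "pairing M \<psi> \<phi> x = hinner ((\<psi> \<circ> s) x) ((\<phi> \<circ> s) x)"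
      if "x \<in> space (restrict_space borel U)" for x
    proof -
      have "proj M (s x) = x" using that s by (simp add: space_restrict_space smooth_section_def)
      then show ?thesis
        using pairing_at[OF assms(1)] assms(2,3) by (simp add: measurable_spinor_def)
    qed
    show "pairing M \<psi> \<phi> \<in> borel_measurable (restrict_space borel U)"
      using meas by (subst measurable_cong[OF eq])
  qed
qed

lemma Re_hinner: "Re (hinner v w) = v \<bullet> w"
  by (simp add: hinner_def inner_vec_def inner_complex_def)

lemma hinner_scale: "hinner (a *s v) (b *s w) = a * cnj b * hinner v w"
  by (simp add: hinner_def sum_distrib_left ac_simps)

lemma pairing_U_weight:
  assumes "riemannian_spin_manifold M"
  shows "pairing M (U_weight M f \<psi>) (U_weight M f \<phi>) x = exp (f x) *\<^sub>R pairing M \<psi> \<phi> x"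
proof -
  define q where "q = (SOME q. proj M q = x)"
  have q: "proj M q = x"
    using proj_surjective[OF assms] unfolding q_def by (rule someI_ex)
  have "hinner (r *\<^sub>R v) (r *\<^sub>R w) = (r * r) *\<^sub>R hinner v w" for r and v w :: "complex ^ 'd"
    by (simp add: hinner_def scaleR_sum_right)
  then show ?thesis
    by (simp add: pairing_def q_def[symmetric] q U_weight_def flip: exp_add)
qed

section \<open>The Hilbert space of square-integrable spinors\<close>

lemma spinor_add: "spinor M \<psi> \<Longrightarrow> spinor M \<phi> \<Longrightarrow> spinor M (\<lambda>p. \<psi> p + \<phi> p)"
  by (simp add: spinor_def matrix_vector_right_distrib)

lemma spinor_scale: "spinor M \<psi> \<Longrightarrow> spinor M (\<lambda>p. a *s \<psi> p)"
  by (simp add: spinor_def vector_scalar_commute)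

lemma measurable_spinor_add:
  assumes "measurable_spinor M \<psi>" "measurable_spinor M \<phi>"
  shows "measurable_spinor M (\<lambda>p. \<psi> p + \<phi> p)"
  using assms by (auto simp: measurable_spinor_def spinor_add comp_def intro!: borel_measurable_add)

lemma measurable_spinor_scale:
  assumes "measurable_spinor M \<psi>"
  shows "measurable_spinor M (\<lambda>p. a *s \<psi> p)"
proof -
  have "continuous_on UNIV (\<lambda>v :: complex ^ 'd. a *s v)"
    by (simp add: vector_scalar_mult_def) (intro continuous_intros)
  from borel_measurable_continuous_on[OF this] show ?thesis
    using assms by (auto simp: measurable_spinor_def spinor_scale comp_def)
qed

text \<open>By the parallelogram law, \<open>|v + w|\<^sup>2 \<le> 2 |v|\<^sup>2 + 2 |w|\<^sup>2\<close>.\<close>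

lemma L2_fun_add:
  assumes "riemannian_spin_manifold M" "sets \<mu> = sets borel"
    and "\<psi> \<in> L2_fun M \<mu>" "\<phi> \<in> L2_fun M \<mu>"
  shows "(\<lambda>p. \<psi> p + \<phi> p) \<in> L2_fun M \<mu>"
proof -
  let ?s = "\<lambda>p. \<psi> p + \<phi> p"
  have m: "measurable_spinor M ?s"
    using assms(3,4) by (auto simp: L2_fun_def measurable_spinor_add)
  have pm: "pairing M ?s ?s \<in> borel_measurable \<mu>"
    using borel_measurable_pairing[OF assms(1) m m] assms(2) by (simp cong: measurable_cong_sets)
  have "integrable \<mu> (\<lambda>x. Re (pairing M ?s ?s x))"
  proof (rule Bochner_Integration.integrable_bound)
    show "integrable \<mu> (\<lambda>x. 2 * Re (pairing M \<psi> \<psi> x) + 2 * Re (pairing M \<phi> \<phi> x))"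
      using assms(3,4) by (auto simp: L2_fun_def)
    show "(\<lambda>x. Re (pairing M ?s ?s x)) \<in> borel_measurable \<mu>"
      using pm by measurable
    have "(v + w) \<bullet> (v + w) \<le> 2 * (v \<bullet> v) + 2 * (w \<bullet> w)" for v w :: "complex ^ 'd"
      using inner_ge_zero[of "v - w"] by (simp add: algebra_simps inner_commute)
    then show "AE x in \<mu>. norm (Re (pairing M ?s ?s x)) \<le>
        norm (2 * Re (pairing M \<psi> \<psi> x) + 2 * Re (pairing M \<phi> \<phi> x))"
      by (simp add: pairing_def Re_hinner Let_def)
  qed
  with m show ?thesis by (simp add: L2_fun_def)
qed

lemma L2_fun_scale:
  assumes "\<psi> \<in> L2_fun M \<mu>"
  shows "(\<lambda>p. a *s \<psi> p) \<in> L2_fun M \<mu>"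
proof -
  have "a * cnj a = of_real ((cmod a)\<^sup>2)" by (simp only: complex_norm_square)
  then have "Re (pairing M (\<lambda>p. a *s \<psi> p) (\<lambda>p. a *s \<psi> p) x) = (cmod a)\<^sup>2 * Re (pairing M \<psi> \<psi> x)" for x
    by (simp add: pairing_def Let_def hinner_scale del: of_real_power)
  with assms show ?thesis by (simp add: L2_fun_def measurable_spinor_scale)
qed

lemma equiv_L2_rel: "equiv (L2_fun M \<mu>) (L2_rel M \<mu>)"
proof (rule equivI)
  show "L2_rel M \<mu> \<subseteq> L2_fun M \<mu> \<times> L2_fun M \<mu>" by (auto simp: L2_rel_def)
  show "refl_on (L2_fun M \<mu>) (L2_rel M \<mu>)" by (simp add: refl_on_def L2_rel_def)
  show "sym (L2_rel M \<mu>)"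
    by (rule symI) (simp add: L2_rel_def eq_commute)
  show "trans (L2_rel M \<mu>)"
  proof (rule transI)
    fix \<psi> \<phi> \<xi> assume rel: "(\<psi>, \<phi>) \<in> L2_rel M \<mu>" "(\<phi>, \<xi>) \<in> L2_rel M \<mu>"
    then have "AE x in \<mu>. \<forall>p. proj M p = x \<longrightarrow> \<psi> p = \<phi> p"
      "AE x in \<mu>. \<forall>p. proj M p = x \<longrightarrow> \<phi> p = \<xi> p" by (simp_all add: L2_rel_def)
    then have "AE x in \<mu>. \<forall>p. proj M p = x \<longrightarrow> \<psi> p = \<xi> p" by eventually_elim simp
    with rel show "(\<psi>, \<xi>) \<in> L2_rel M \<mu>" by (simp add: L2_rel_def)
  qed
qed

lemma L2_class_in_carrier: "\<psi> \<in> L2_fun M \<mu> \<Longrightarrow> L2_class M \<mu> \<psi> \<in> hcarrier (L2 M \<mu>)"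
  by (simp add: L2_def L2_class_def quotientI)

lemma L2_class_eqI: "(\<psi>, \<phi>) \<in> L2_rel M \<mu> \<Longrightarrow> L2_class M \<mu> \<psi> = L2_class M \<mu> \<phi>"
  unfolding L2_class_def by (rule equiv_class_eq[OF equiv_L2_rel])

text \<open>The operations of \<open>L2\<close> are defined through chosen representatives; these lemmas allow them
  to be exchanged for others.\<close>

lemma L2_repr:
  assumes "X \<in> hcarrier (L2 M \<mu>)"
  shows "repr X \<in> L2_fun M \<mu>" "X = L2_class M \<mu> (repr X)"
proof -
  obtain \<psi> where \<psi>: "X = L2_rel M \<mu> `` {\<psi>}" "\<psi> \<in> L2_fun M \<mu>"
    using assms by (auto simp: L2_def elim: quotientE)
  then have "\<psi> \<in> X" using equiv_class_self[OF equiv_L2_rel] by blast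
  then have "repr X \<in> X" by (rule someI[of "\<lambda>\<psi>. \<psi> \<in> X"])
  then have "(\<psi>, repr X) \<in> L2_rel M \<mu>" using \<psi> by simp
  then show "repr X \<in> L2_fun M \<mu>" "X = L2_class M \<mu> (repr X)"
    using L2_class_eqI[of \<psi> "repr X" M \<mu>]
    unfolding \<psi>(1)[folded L2_class_def] by (simp_all only: L2_rel_def) auto
qed

lemma repr_L2_class:
  assumes "\<psi> \<in> L2_fun M \<mu>"
  shows "(\<psi>, repr (L2_class M \<mu> \<psi>)) \<in> L2_rel M \<mu>"
proof -
  have "\<psi> \<in> L2_class M \<mu> \<psi>"
    unfolding L2_class_def using equiv_class_self[OF equiv_L2_rel] assms by blast
  then have "repr (L2_class M \<mu> \<psi>) \<in> L2_class M \<mu> \<psi>"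
    by (rule someI[of "\<lambda>\<phi>. \<phi> \<in> L2_class M \<mu> \<psi>"])
  then show ?thesis by (simp add: L2_class_def)
qed

lemma L2_rel_add:
  assumes "riemannian_spin_manifold M" "sets \<mu> = sets borel"
    and "(\<psi>, \<psi>') \<in> L2_rel M \<mu>" "(\<phi>, \<phi>') \<in> L2_rel M \<mu>"
  shows "(\<lambda>p. \<psi> p + \<phi> p, \<lambda>p. \<psi>' p + \<phi>' p) \<in> L2_rel M \<mu>"
proof -
  have "AE x in \<mu>. \<forall>p. proj M p = x \<longrightarrow> \<psi> p = \<psi>' p" "AE x in \<mu>. \<forall>p. proj M p = x \<longrightarrow> \<phi> p = \<phi>' p"
    using assms(3,4) by (auto simp: L2_rel_def)
  then have "AE x in \<mu>. \<forall>p. proj M p = x \<longrightarrow> \<psi> p + \<phi> p = \<psi>' p + \<phi>' p"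
    by eventually_elim simp
  with assms(3,4) L2_fun_add[OF assms(1,2)] show ?thesis by (simp add: L2_rel_def)
qed

lemma L2_rel_scale:
  assumes "(\<psi>, \<phi>) \<in> L2_rel M \<mu>"
  shows "(\<lambda>p. a *s \<psi> p, \<lambda>p. a *s \<phi> p) \<in> L2_rel M \<mu>"
proof -
  have "AE x in \<mu>. \<forall>p. proj M p = x \<longrightarrow> \<psi> p = \<phi> p"
    using assms by (simp add: L2_rel_def)
  then have "AE x in \<mu>. \<forall>p. proj M p = x \<longrightarrow> a *s \<psi> p = a *s \<phi> p"
    by eventually_elim simp
  with assms show ?thesis by (auto simp: L2_rel_def intro: L2_fun_scale)
qed

lemma integral_pairing_cong:
  assumes "riemannian_spin_manifold M" "sets \<mu> = sets borel"
    and "(\<psi>, \<psi>') \<in> L2_rel M \<mu>" "(\<phi>, \<phi>') \<in> L2_rel M \<mu>"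
  shows "(\<integral>x. pairing M \<psi> \<phi> x \<partial>\<mu>) = (\<integral>x. pairing M \<psi>' \<phi>' x \<partial>\<mu>)"
proof (rule integral_cong_AE)
  have mu: "pairing M \<alpha> \<beta> \<in> borel_measurable \<mu>" if "\<alpha> \<in> L2_fun M \<mu>" "\<beta> \<in> L2_fun M \<mu>" for \<alpha> \<beta>
    using borel_measurable_pairing[OF assms(1), of \<alpha> \<beta>] that assms(2)
    by (simp add: L2_fun_def cong: measurable_cong_sets)
  show "pairing M \<psi> \<phi> \<in> borel_measurable \<mu>" "pairing M \<psi>' \<phi>' \<in> borel_measurable \<mu>"
    using assms(3,4) by (auto simp: L2_rel_def intro: mu)
  have "AE x in \<mu>. \<forall>p. proj M p = x \<longrightarrow> \<psi> p = \<psi>' p" "AE x in \<mu>. \<forall>p. proj M p = x \<longrightarrow> \<phi> p = \<phi>' p"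
    using assms(3,4) by (auto simp: L2_rel_def)
  then show "AE x in \<mu>. pairing M \<psi> \<phi> x = pairing M \<psi>' \<phi>' x"
  proof eventually_elim
    case (elim x)
    have "proj M (SOME p. proj M p = x) = x"
      using proj_surjective[OF assms(1)] by (rule someI_ex)
    with elim show ?case by (simp add: pairing_def Let_def)
  qed
qed

lemma hclosed_L2:
  assumes "riemannian_spin_manifold M" "sets \<mu> = sets borel"
  shows "hclosed (L2 M \<mu>)"
proof -
  have "hadd (L2 M \<mu>) X Y \<in> hcarrier (L2 M \<mu>)"
    if "X \<in> hcarrier (L2 M \<mu>)" "Y \<in> hcarrier (L2 M \<mu>)" for X Y
  proof -
    have "(\<lambda>p. repr X p + repr Y p) \<in> L2_fun M \<mu>"
      using that by (intro L2_fun_add[OF assms] L2_repr(1))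
    from L2_class_in_carrier[OF this] show ?thesis by (simp add: L2_def)
  qed
  moreover have "hscale (L2 M \<mu>) a X \<in> hcarrier (L2 M \<mu>)" if "X \<in> hcarrier (L2 M \<mu>)" for a X
  proof -
    have "(\<lambda>p. a *s repr X p) \<in> L2_fun M \<mu>" using that by (intro L2_fun_scale L2_repr(1))
    from L2_class_in_carrier[OF this] show ?thesis by (simp add: L2_def)
  qed
  ultimately show ?thesis by (simp add: hclosed_def)
qed

section \<open>The unitary map\<close>

lemma sets_weighted_measure: "sets (weighted_measure \<mu> f) = sets \<mu>"
  by (simp add: weighted_measure_def)

text \<open>The density is strictly positive, so both measures have the same null sets.\<close>

lemma AE_weighted_measure:
  assumes "f \<in> borel_measurable \<mu>"
  shows "(AE x in weighted_measure \<mu> f. P x) \<longleftrightarrow> (AE x in \<mu>. P x)"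
proof -
  have "(\<lambda>x. ennreal (exp (- f x))) \<in> borel_measurable \<mu>" using assms by measurable
  then show ?thesis by (simp only: weighted_measure_def AE_density) simp
qed

text \<open>The factor \<open>exp f\<close> of the pointwise square norm cancels the density \<open>exp (- f)\<close>.\<close>

lemma L2_fun_U_weight_iff:
  assumes "riemannian_spin_manifold M" "smooth_fun M f" "sets \<mu> = sets borel"
  shows "U_weight M f \<psi> \<in> L2_fun M (weighted_measure \<mu> f) \<longleftrightarrow> \<psi> \<in> L2_fun M \<mu>"
proof -
  have M: "oriented_riemannian_manifold M"
    using assms(1) by (auto simp: riemannian_spin_manifold_def)
  have ms: "measurable_spinor M (U_weight M f \<psi>) \<longleftrightarrow> measurable_spinor M \<psi>"
    using measurable_spinor_U_weight[OF assms(1,2), of \<psi>]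
      measurable_spinor_U_weight[OF assms(1) smooth_fun_uminus[OF M assms(2)], of "U_weight M f \<psi>"]
    by auto
  have [measurable]: "f \<in> borel_measurable \<mu>"
    using borel_measurable_smooth_fun[OF M assms(2)] assms(3) by (simp cong: measurable_cong_sets)
  let ?p = "\<lambda>x. Re (pairing M (U_weight M f \<psi>) (U_weight M f \<psi>) x)"
  have "integrable (weighted_measure \<mu> f) ?p \<longleftrightarrow> integrable \<mu> (\<lambda>x. Re (pairing M \<psi> \<psi> x))"
    if "measurable_spinor M (U_weight M f \<psi>)"
  proof -
    have [measurable]: "pairing M (U_weight M f \<psi>) (U_weight M f \<psi>) \<in> borel_measurable \<mu>"
      using borel_measurable_pairing[OF assms(1) that that] assms(3)
      by (simp cong: measurable_cong_sets)
    have "integrable (weighted_measure \<mu> f) ?p \<longleftrightarrow> integrable \<mu> (\<lambda>x. exp (- f x) *\<^sub>R ?p x)"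
      unfolding weighted_measure_def by (intro integrable_density) auto
    moreover have "exp (- f x) *\<^sub>R ?p x = Re (pairing M \<psi> \<psi> x)" for x
      by (simp add: pairing_U_weight[OF assms(1)] exp_minus)
    ultimately show ?thesis by simp
  qed
  with ms show ?thesis by (auto simp: L2_fun_def)
qed

lemma integral_pairing_U_weight:
  assumes "riemannian_spin_manifold M" "smooth_fun M f" "sets \<mu> = sets borel"
    and "\<psi> \<in> L2_fun M \<mu>" "\<phi> \<in> L2_fun M \<mu>"
  shows "(\<integral>x. pairing M (U_weight M f \<psi>) (U_weight M f \<phi>) x \<partial>weighted_measure \<mu> f) =
    (\<integral>x. pairing M \<psi> \<phi> x \<partial>\<mu>)"
proof -
  have M: "oriented_riemannian_manifold M"
    using assms(1) by (auto simp: riemannian_spin_manifold_def)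
  have [measurable]: "f \<in> borel_measurable \<mu>"
    using borel_measurable_smooth_fun[OF M assms(2)] assms(3) by (simp cong: measurable_cong_sets)
  have "pairing M \<psi> \<phi> \<in> borel_measurable borel"
    using assms(1,4,5) by (intro borel_measurable_pairing) (auto simp: L2_fun_def)
  then have [measurable]: "pairing M \<psi> \<phi> \<in> borel_measurable \<mu>"
    using assms(3) by (simp cong: measurable_cong_sets)
  have "(\<integral>x. exp (f x) *\<^sub>R pairing M \<psi> \<phi> x \<partial>weighted_measure \<mu> f) =
      (\<integral>x. exp (- f x) *\<^sub>R exp (f x) *\<^sub>R pairing M \<psi> \<phi> x \<partial>\<mu>)"
    unfolding weighted_measure_def by (intro integral_density) auto
  then show ?thesis by (simp add: pairing_U_weight[OF assms(1)] flip: exp_add)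
qed

lemma U_weight_eq_iff: "U_weight M f \<psi> p = U_weight M f \<phi> p \<longleftrightarrow> \<psi> p = \<phi> p"
  by (simp add: U_weight_def)

lemma L2_rel_U_weight_iff:
  assumes "riemannian_spin_manifold M" "smooth_fun M f" "sets \<mu> = sets borel"
  shows "(U_weight M f \<psi>, U_weight M f \<phi>) \<in> L2_rel M (weighted_measure \<mu> f) \<longleftrightarrow>
    (\<psi>, \<phi>) \<in> L2_rel M \<mu>"
proof -
  have "f \<in> borel_measurable \<mu>"
    using borel_measurable_smooth_fun[OF _ assms(2)] assms(1,3)
    by (simp add: riemannian_spin_manifold_def cong: measurable_cong_sets)
  then show ?thesis
    by (simp add: L2_rel_def L2_fun_U_weight_iff[OF assms] U_weight_eq_iff AE_weighted_measure)
qed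

text \<open>Both inclusions use that multiplication by the weight is a bijection of all spinors which
  respects the equivalence in both directions.  The spinor \<open>\<psi>\<close> is arbitrary; if it is not
  square-integrable, both classes are empty.\<close>

lemma U_weight_image_L2_class:
  assumes "riemannian_spin_manifold M" "smooth_fun M f" "sets \<mu> = sets borel"
  shows "U_weight M f ` L2_class M \<mu> \<psi> = L2_class M (weighted_measure \<mu> f) (U_weight M f \<psi>)"
proof (intro set_eqI iffI)
  fix \<phi> assume "\<phi> \<in> U_weight M f ` L2_class M \<mu> \<psi>"
  then obtain \<xi> where "\<phi> = U_weight M f \<xi>" "(\<psi>, \<xi>) \<in> L2_rel M \<mu>"
    unfolding L2_class_def by blast
  then show "\<phi> \<in> L2_class M (weighted_measure \<mu> f) (U_weight M f \<psi>)"
    by (simp only: L2_class_def Image_singleton_iff L2_rel_U_weight_iff[OF assms])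
next
  fix \<phi> assume \<phi>: "\<phi> \<in> L2_class M (weighted_measure \<mu> f) (U_weight M f \<psi>)"
  define \<xi> where "\<xi> = U_weight M (\<lambda>x. - f x) \<phi>"
  have \<xi>: "\<phi> = U_weight M f \<xi>" by (simp add: \<xi>_def)
  have "(\<psi>, \<xi>) \<in> L2_rel M \<mu>"
    using \<phi> unfolding \<xi> by (simp only: L2_class_def Image_singleton_iff L2_rel_U_weight_iff[OF assms])
  then show "\<phi> \<in> U_weight M f ` L2_class M \<mu> \<psi>"
    unfolding \<xi> L2_class_def by blast
qed

text \<open>Sums, multiples and products of classes are formed from the representatives chosen on each
  side.  The image of the chosen representative of \<open>X\<close> need not be the one chosen for the image of
  \<open>X\<close>, but the two are equivalent (\<open>rep\<close>), and the operations respect the equivalence.\<close>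

lemma unitary_U_weight:
  assumes "riemannian_spin_manifold M" "smooth_fun M f" "sets \<mu> = sets borel"
  shows "unitary (L2 M \<mu>) (L2 M (weighted_measure \<mu> f)) ((`) (U_weight M f))"
    (is "unitary ?H ?K ?W")
proof -
  let ?w = "weighted_measure \<mu> f" and ?U = "U_weight M f"
  have w: "sets ?w = sets borel" using assms(3) by (simp add: sets_weighted_measure)
  note cls = U_weight_image_L2_class[OF assms] and fn = L2_fun_U_weight_iff[OF assms]
  have W: "?W X = L2_class M ?w (?U (repr X))" "?U (repr X) \<in> L2_fun M ?w"
    if "X \<in> hcarrier ?H" for X
    using L2_repr[OF that] cls[of "repr X"] fn by simp_all
  have rep: "(?U (repr X), repr (?W X)) \<in> L2_rel M ?w" if "X \<in> hcarrier ?H" for X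
    using repr_L2_class[OF W(2)[OF that]] W(1)[OF that] by simp
  have "inj ?U" by (rule inj_on_inverseI[of _ "U_weight M (\<lambda>x. - f x)"]) simp
  then have inj: "inj_on ?W (hcarrier ?H)" by (intro inj_onI) (simp add: inj_image_eq_iff)
  have surj: "?W ` hcarrier ?H = hcarrier ?K"
  proof (intro set_eqI iffI)
    fix Y assume "Y \<in> ?W ` hcarrier ?H"
    then show "Y \<in> hcarrier ?K" using W L2_class_in_carrier by fastforce
  next
    fix Y assume Y: "Y \<in> hcarrier ?K"
    define \<xi> where "\<xi> = U_weight M (\<lambda>x. - f x) (repr Y)"
    have \<xi>: "repr Y = ?U \<xi>" by (simp add: \<xi>_def)
    have "\<xi> \<in> L2_fun M \<mu>" using L2_repr(1)[OF Y] fn by (simp add: \<xi>)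
    moreover have "Y = ?W (L2_class M \<mu> \<xi>)" using L2_repr(2)[OF Y] by (simp add: \<xi> cls)
    ultimately show "Y \<in> ?W ` hcarrier ?H" using L2_class_in_carrier by blast
  qed
  show ?thesis
    unfolding unitary_def
  proof (intro conjI ballI allI)
    show "bij_betw ?W (hcarrier ?H) (hcarrier ?K)" using inj surj by (simp add: bij_betw_def)
    fix X assume X: "X \<in> hcarrier ?H"
    {
      fix Y assume Y: "Y \<in> hcarrier ?H"
      have "?W (hadd ?H X Y) = L2_class M ?w (?U (\<lambda>p. repr X p + repr Y p))"
        by (simp add: L2_def cls)
      also have "?U (\<lambda>p. repr X p + repr Y p) = (\<lambda>p. ?U (repr X) p + ?U (repr Y) p)"
        by (simp add: U_weight_def scaleR_add_right fun_eq_iff)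
      also have "L2_class M ?w \<dots> = L2_class M ?w (\<lambda>p. repr (?W X) p + repr (?W Y) p)"
        by (intro L2_class_eqI L2_rel_add[OF assms(1) w] rep X Y)
      also have "\<dots> = hadd ?K (?W X) (?W Y)" by (simp add: L2_def)
      finally show "?W (hadd ?H X Y) = hadd ?K (?W X) (?W Y)" .
      have "hprod ?K (?W X) (?W Y) = (\<integral>x. pairing M (repr (?W X)) (repr (?W Y)) x \<partial>?w)"
        by (simp add: L2_def)
      also have "\<dots> = (\<integral>x. pairing M (?U (repr X)) (?U (repr Y)) x \<partial>?w)"
        using integral_pairing_cong[OF assms(1) w rep[OF X] rep[OF Y]] by simp
      also have "\<dots> = (\<integral>x. pairing M (repr X) (repr Y) x \<partial>\<mu>)"
        by (intro integral_pairing_U_weight[OF assms] L2_repr(1) X Y)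
      finally show "hprod ?K (?W X) (?W Y) = hprod ?H X Y" by (simp add: L2_def)
    }
    fix a
    have "?W (hscale ?H a X) = L2_class M ?w (?U (\<lambda>p. a *s repr X p))"
      by (simp add: L2_def cls)
    also have "?U (\<lambda>p. a *s repr X p) = (\<lambda>p. a *s ?U (repr X) p)"
      by (simp add: U_weight_def fun_eq_iff vec_eq_iff)
    also have "L2_class M ?w \<dots> = L2_class M ?w (\<lambda>p. a *s repr (?W X) p)"
      by (intro L2_class_eqI L2_rel_scale rep X)
    also have "\<dots> = hscale ?K a (?W X)" by (simp add: L2_def)
    finally show "?W (hscale ?H a X) = hscale ?K a (?W X)" .
  qed
qed

section \<open>Unitary equivalence of the two Dirac operators\<close>

lemma test_spinor_U_weight:
  assumes "riemannian_spin_manifold M" "smooth_fun M f" "test_spinor M \<psi>"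
  shows "test_spinor M (U_weight M f \<psi>)"
proof -
  have "{proj M p |p. U_weight M f \<psi> p \<noteq> 0} = {proj M p |p. \<psi> p \<noteq> 0}"
    by (simp add: U_weight_def)
  with assms show ?thesis by (simp add: test_spinor_def Ck_spinor_U_weight)
qed

text \<open>The operator of \<open>T\<close> is the closure of this graph, on which \<open>T\<close> is still a differential
  expression and the pointwise product rule applies.\<close>

definition dirac_core where
  "dirac_core M \<mu> T = {(L2_class M \<mu> \<psi>, L2_class M \<mu> (T \<psi>)) |\<psi>.
     test_spinor M \<psi> \<and> \<psi> \<in> L2_fun M \<mu> \<and> T \<psi> \<in> L2_fun M \<mu>}"

lemma dirac_core_in_carrier:
  "dirac_core M \<mu> T \<subseteq> hcarrier (L2 M \<mu>) \<times> hcarrier (L2 M \<mu>)"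
  by (auto simp: dirac_core_def L2_class_in_carrier)

text \<open>Multiplication by the weight preserves smoothness and support, and so does its inverse; on
  test spinors the two differential expressions are intertwined.\<close>

lemma dirac_core_U_weight:
  assumes "riemannian_spin_manifold M" "smooth_fun M f" "sets \<mu> = sets borel"
  shows "dirac_core M (weighted_measure \<mu> f) (weighted_dirac M f) =
    map_prod ((`) (U_weight M f)) ((`) (U_weight M f)) ` dirac_core M \<mu> (dirac M)"
proof -
  let ?w = "weighted_measure \<mu> f" and ?U = "U_weight M f"
  have "smooth_fun M (\<lambda>x. - f x)"
    using assms by (simp add: riemannian_spin_manifold_def smooth_fun_uminus)
  then have test: "test_spinor M (?U \<psi>) \<longleftrightarrow> test_spinor M \<psi>" for \<psi>
    using test_spinor_U_weight[OF assms(1,2), of \<psi>]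
      test_spinor_U_weight[OF assms(1), of "\<lambda>x. - f x" "?U \<psi>"] by auto
  have rel: "weighted_dirac M f (?U \<psi>) = ?U (dirac M \<psi>)" if "test_spinor M \<psi>" for \<psi>
    using that weighted_dirac_U_weight[OF assms(1,2)] by (simp add: test_spinor_def)
  have core: "test_spinor M (?U \<psi>) \<and> ?U \<psi> \<in> L2_fun M ?w \<and> weighted_dirac M f (?U \<psi>) \<in> L2_fun M ?w \<longleftrightarrow>
    test_spinor M \<psi> \<and> \<psi> \<in> L2_fun M \<mu> \<and> dirac M \<psi> \<in> L2_fun M \<mu>" for \<psi>
    using rel[of \<psi>] by (auto simp: test L2_fun_U_weight_iff[OF assms])
  show ?thesis
  proof (intro set_eqI iffI)
    fix z assume "z \<in> dirac_core M ?w (weighted_dirac M f)"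
    then obtain \<phi> where z: "z = (L2_class M ?w \<phi>, L2_class M ?w (weighted_dirac M f \<phi>))"
      and \<phi>: "test_spinor M \<phi> \<and> \<phi> \<in> L2_fun M ?w \<and> weighted_dirac M f \<phi> \<in> L2_fun M ?w"
      by (auto simp: dirac_core_def)
    define \<psi> where "\<psi> = U_weight M (\<lambda>x. - f x) \<phi>"
    have U: "\<phi> = ?U \<psi>" by (simp add: \<psi>_def)
    have \<psi>: "test_spinor M \<psi> \<and> \<psi> \<in> L2_fun M \<mu> \<and> dirac M \<psi> \<in> L2_fun M \<mu>"
      using \<phi> core[of \<psi>] by (simp only: U)
    then have "z = map_prod ((`) ?U) ((`) ?U) (L2_class M \<mu> \<psi>, L2_class M \<mu> (dirac M \<psi>))"
      by (simp add: z U rel U_weight_image_L2_class[OF assms])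
    moreover have "(L2_class M \<mu> \<psi>, L2_class M \<mu> (dirac M \<psi>)) \<in> dirac_core M \<mu> (dirac M)"
      unfolding dirac_core_def using \<psi> by blast
    ultimately show "z \<in> map_prod ((`) ?U) ((`) ?U) ` dirac_core M \<mu> (dirac M)" by (rule image_eqI)
  next
    fix z assume "z \<in> map_prod ((`) ?U) ((`) ?U) ` dirac_core M \<mu> (dirac M)"
    then obtain \<psi> where z: "z = (?U ` L2_class M \<mu> \<psi>, ?U ` L2_class M \<mu> (dirac M \<psi>))"
      and \<psi>: "test_spinor M \<psi> \<and> \<psi> \<in> L2_fun M \<mu> \<and> dirac M \<psi> \<in> L2_fun M \<mu>"
      by (auto simp: dirac_core_def)
    have "z = (L2_class M ?w (?U \<psi>), L2_class M ?w (weighted_dirac M f (?U \<psi>)))"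
      using \<psi> by (simp add: z rel U_weight_image_L2_class[OF assms])
    then show "z \<in> dirac_core M ?w (weighted_dirac M f)"
      unfolding dirac_core_def using core[of \<psi>] \<psi> by blast
  qed
qed

lemma weighted_dirac_op_image:
  assumes "riemannian_spin_manifold M" "smooth_fun M f" "sets \<mu> = sets borel"
  shows "weighted_dirac_op M \<mu> f =
    map_prod ((`) (U_weight M f)) ((`) (U_weight M f)) ` dirac_op M \<mu>"
  unfolding weighted_dirac_op_def dirac_op_def L2_operator_def dirac_core_def[symmetric]
    dirac_core_U_weight[OF assms]
  by (intro closure_op_unitary_image unitary_U_weight assms hclosed_L2 dirac_core_in_carrier)

lemma dirac_op_in_carrier: "dirac_op M \<mu> \<subseteq> hcarrier (L2 M \<mu>) \<times> hcarrier (L2 M \<mu>)"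
  by (auto simp: dirac_op_def L2_operator_def closure_op_def)

theorem proposition2p20:
  fixes M :: "('m::{t2_space, second_countable_topology}, 'n::finite,
               'p::topological_space, 's::finite) spin_mfd"
    and dV :: "'m measure" and f :: "'m \<Rightarrow> real"
  assumes "riemannian_spin_manifold M"
    and "riem_complete M"
    and "riem_volume M dV"
    and "smooth_fun M f"
  shows "unitarily_equivalent (L2 M dV) (dirac_op M dV)
           (L2 M (weighted_measure dV f)) (weighted_dirac_op M dV f) \<and>
         isospectral (L2 M dV) (dirac_op M dV)
           (L2 M (weighted_measure dV f)) (weighted_dirac_op M dV f) \<and>
         (\<forall>\<psi>. Ck_spinor 1 M \<psi> \<longrightarrow>
           U_weight M f (dirac M (U_weight M (\<lambda>x. - f x) \<psi>)) = weighted_dirac M f \<psi>) \<and>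
         (\<forall>\<psi>. Ck_spinor 1 M \<psi> \<longrightarrow>
           (dirac M \<psi> = (\<lambda>p. 0) \<longleftrightarrow> weighted_dirac M f (U_weight M f \<psi>) = (\<lambda>p. 0)))"
proof -
  have dV: "sets dV = sets borel" using assms(3) by (simp add: riem_volume_def)
  note U = unitary_U_weight[OF assms(1,4) dV] and img = weighted_dirac_op_image[OF assms(1,4) dV]
  show ?thesis
  proof (intro conjI allI impI)
    show "unitarily_equivalent (L2 M dV) (dirac_op M dV)
           (L2 M (weighted_measure dV f)) (weighted_dirac_op M dV f)"
      unfolding img by (rule unitarily_equivalent_image[OF U dirac_op_in_carrier])
    show "isospectral (L2 M dV) (dirac_op M dV)
           (L2 M (weighted_measure dV f)) (weighted_dirac_op M dV f)"
      unfolding img by (rule isospectral_image[OF U hclosed_L2[OF assms(1) dV] dirac_op_in_carrier])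
    fix \<psi> assume \<psi>: "Ck_spinor 1 M \<psi>"
    show "U_weight M f (dirac M (U_weight M (\<lambda>x. - f x) \<psi>)) = weighted_dirac M f \<psi>"
      by (rule U_weight_dirac_U_weight[OF assms(1,4) \<psi>])
    show "dirac M \<psi> = (\<lambda>p. 0) \<longleftrightarrow> weighted_dirac M f (U_weight M f \<psi>) = (\<lambda>p. 0)"
      unfolding weighted_dirac_U_weight[OF assms(1,4) \<psi>] by (simp add: U_weight_def fun_eq_iff)
  qed
qed

end
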